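(* Let $1\to Z\xrightarrow{\iota}E\xrightarrow{\pi}G\to 1$ be a central extension of groups with $Z$ finitely generated, identify $Z$ with $\iota(Z)$, let $[\omega]\in H^2(G,Z)$ be its Euler class, and write $Z\cong\mathbb{Z}^r\oplus F$ with $r\ge 0$ and $F$ a finite abelian group. The following are equivalent: (1) $[\omega]$ is bounded. (2) The central extension quasi-splits. (3) The central extension admits a quasi-retraction. (4) There exist quasi-lines $L_1,\dots,L_r$ on which $E$ acts lineally and orientably such that the diagonal action of $Z$ on $\prod_{i=1}^r L_i$ is geometric. (5) The central extension virtually quasi-splits.
   Context: Euler class: for a set-theoretic section $s:G\to E$ of $\pi$, put $\omega_s(g_1,g_2)=s(g_1)s(g_2)s(g_1g_2)^{-1}\in Z$; this is a 2-cocycle whose class $[\omega]\in H^2(G,Z)$ does not depend on $s$. It is bounded if it can be represented by a cocycle $G\times G\to Z$ with finite image. A map of groups $\phi:A\to B$ is a quasi-homomorphism if the set $\{\phi(h)^{-1}\phi(g)^{-1}\phi(gh):g,h\in A\}\subseteq B$ is finite. The extension quasi-splits if there is a section $s:G\to E$ of $\pi$ (i.e. $\pi\circ s=\mathrm{id}_G$) with $s(1)=1$ that is a quasi-homomorphism. It virtually quasi-splits if there is a finite-index subgroup $E'\le E$ such that the extension $1\to Z\cap E'\to E'\to\pi(E')\to 1$ (restriction of $\iota$ and $\pi$) quasi-splits. A quasi-retraction is a quasi-homomorphism $\phi:E\to Z$ with $\phi|_Z=\mathrm{id}_Z$. A quasi-line is a metric space quasi-isometric to $\mathbb{R}$, equipped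 with the path metric (so it is Gromov hyperbolic). An isometry of a hyperbolic space $X$ is elliptic if it has a bounded orbit under its powers; otherwise it is loxodromic if it has exactly two fixed points in the Gromov boundary $\partial X$. An isometric action on a hyperbolic space is lineal if it has a loxodromic element and any two loxodromic elements have the same fixed points in $\partial X$; a lineal action is orientable if no group element permutes (swaps) its two limit points. An isometric action on a metric space $X$ is proper if $\{g: d(x,gx)\le R\}$ is finite for all $x\in X$, $R>0$, cobounded if some orbit is $\epsilon$-dense for some $\epsilon\ge0$, and geometric if it is proper and cobounded. Products carry the $\ell^1$-metric. *)

theory Defs
  imports
    "HOL-Algebra.Algebra"
    "HOL-Analysis.Analysis"
begin

section \<open>Central extensions and the Euler class\<close>

locale central_extension = Z: group Z + E: group E + G: group G
  for Z :: "('z, 'm) monoid_scheme" and E :: "('e, 'n) monoid_scheme"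
    and G :: "('g, 'k) monoid_scheme" +
  fixes \<iota> :: "'z \<Rightarrow> 'e" and \<pi> :: "'e \<Rightarrow> 'g"
  assumes iota_hom: "\<iota> \<in> hom Z E"
    and iota_inj: "inj_on \<iota> (carrier Z)"
    and pi_hom: "\<pi> \<in> hom E G"
    and pi_surj: "\<pi> ` carrier E = carrier G"
    and exact: "kernel E G \<pi> = \<iota> ` carrier Z"
    and central: "\<lbrakk>z \<in> carrier Z; e \<in> carrier E\<rbrakk> \<Longrightarrow> \<iota> z \<otimes>\<^bsub>E\<^esub> e = e \<otimes>\<^bsub>E\<^esub> \<iota> z"

definition finitely_generated_group :: "('a, 'm) monoid_scheme \<Rightarrow> bool" where
  "finitely_generated_group A \<longleftrightarrow>
     (\<exists>S. finite S \<and> S \<subseteq> carrier A \<and> generate A S = carrier A)"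

definition is_section ::
  "('e, 'n) monoid_scheme \<Rightarrow> ('g, 'k) monoid_scheme \<Rightarrow> ('e \<Rightarrow> 'g) \<Rightarrow> ('g \<Rightarrow> 'e) \<Rightarrow> bool" where
  "is_section E G \<pi> s \<longleftrightarrow>
     s \<in> carrier G \<rightarrow> carrier E \<and> (\<forall>g\<in>carrier G. \<pi> (s g) = g)"

text \<open>Inhomogeneous cochains with trivial action on the coefficient group \<open>A\<close>, as extensional
  functions on pairs.\<close>

definition cochains2 ::
  "('g, 'k) monoid_scheme \<Rightarrow> ('a, 'm) monoid_scheme \<Rightarrow> ('g \<times> 'g \<Rightarrow> 'a) monoid" where
  "cochains2 G A = product_group (carrier G \<times> carrier G) (\<lambda>_. A)"

definition cocycles2 ::
  "('g, 'k) monoid_scheme \<Rightarrow> ('a, 'm) monoid_scheme \<Rightarrow> ('g \<times> 'g \<Rightarrow> 'a) set" where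
  "cocycles2 G A = {c \<in> carrier (cochains2 G A).
     \<forall>g\<in>carrier G. \<forall>h\<in>carrier G. \<forall>k\<in>carrier G.
       c (g, h) \<otimes>\<^bsub>A\<^esub> c (g \<otimes>\<^bsub>G\<^esub> h, k) = c (h, k) \<otimes>\<^bsub>A\<^esub> c (g, h \<otimes>\<^bsub>G\<^esub> k)}"

definition coboundary1 ::
  "('g, 'k) monoid_scheme \<Rightarrow> ('a, 'm) monoid_scheme \<Rightarrow> ('g \<Rightarrow> 'a) \<Rightarrow> 'g \<times> 'g \<Rightarrow> 'a" where
  "coboundary1 G A b = (\<lambda>(g, h)\<in>carrier G \<times> carrier G.
     b g \<otimes>\<^bsub>A\<^esub> b h \<otimes>\<^bsub>A\<^esub> inv\<^bsub>A\<^esub> (b (g \<otimes>\<^bsub>G\<^esub> h)))"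

definition coboundaries2 ::
  "('g, 'k) monoid_scheme \<Rightarrow> ('a, 'm) monoid_scheme \<Rightarrow> ('g \<times> 'g \<Rightarrow> 'a) set" where
  "coboundaries2 G A = coboundary1 G A ` (carrier G \<rightarrow> carrier A)"

definition H2 ::
  "('g, 'k) monoid_scheme \<Rightarrow> ('a, 'm) monoid_scheme \<Rightarrow> ('g \<times> 'g \<Rightarrow> 'a) set monoid" where
  "H2 G A = (cochains2 G A)\<lparr>carrier := cocycles2 G A\<rparr> Mod coboundaries2 G A"

definition cohomology_class ::
  "('g, 'k) monoid_scheme \<Rightarrow> ('a, 'm) monoid_scheme \<Rightarrow> ('g \<times> 'g \<Rightarrow> 'a) \<Rightarrow> ('g \<times> 'g \<Rightarrow> 'a) set" where
  "cohomology_class G A c = coboundaries2 G A #>\<^bsub>cochains2 G A\<^esub> c"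

text \<open>\<open>s(g) s(h) s(gh)\<^sup>-\<^sup>1\<close>, read in \<open>Z\<close> through the inverse of \<open>\<iota>\<close>.\<close>

definition euler_cocycle ::
  "('z, 'm) monoid_scheme \<Rightarrow> ('e, 'n) monoid_scheme \<Rightarrow> ('g, 'k) monoid_scheme \<Rightarrow>
   ('z \<Rightarrow> 'e) \<Rightarrow> ('g \<Rightarrow> 'e) \<Rightarrow> 'g \<times> 'g \<Rightarrow> 'z" where
  "euler_cocycle Z E G \<iota> s = (\<lambda>(g, h)\<in>carrier G \<times> carrier G.
     inv_into (carrier Z) \<iota> (s g \<otimes>\<^bsub>E\<^esub> s h \<otimes>\<^bsub>E\<^esub> inv\<^bsub>E\<^esub> (s (g \<otimes>\<^bsub>G\<^esub> h))))"

text \<open>The choice of section is immaterial, see \<open>euler_class_eq\<close> below.\<close>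

definition euler_class ::
  "('z, 'm) monoid_scheme \<Rightarrow> ('e, 'n) monoid_scheme \<Rightarrow> ('g, 'k) monoid_scheme \<Rightarrow>
   ('z \<Rightarrow> 'e) \<Rightarrow> ('e \<Rightarrow> 'g) \<Rightarrow> ('g \<times> 'g \<Rightarrow> 'z) set" where
  "euler_class Z E G \<iota> \<pi> =
     cohomology_class G Z (euler_cocycle Z E G \<iota> (SOME s. is_section E G \<pi> s))"

definition bounded_class :: "('g, 'k) monoid_scheme \<Rightarrow> ('g \<times> 'g \<Rightarrow> 'a) set \<Rightarrow> bool" where
  "bounded_class G \<xi> \<longleftrightarrow> (\<exists>c\<in>\<xi>. finite (c ` (carrier G \<times> carrier G)))"

context central_extension
begin

lemma group_hom_iota: "group_hom Z E \<iota>"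
  by (simp add: group_hom_axioms_def group_hom_def iota_hom Z.is_group E.is_group)

lemma group_hom_pi: "group_hom E G \<pi>"
  by (simp add: group_hom_axioms_def group_hom_def pi_hom G.is_group E.is_group)

sublocale iota: group_hom Z E \<iota> by (rule group_hom_iota)
sublocale pi: group_hom E G \<pi> by (rule group_hom_pi)

lemma Z_comm: "comm_group Z"
proof (rule Z.group_comm_groupI)
  fix x y assume xy: "x \<in> carrier Z" "y \<in> carrier Z"
  then have "\<iota> (x \<otimes>\<^bsub>Z\<^esub> y) = \<iota> (y \<otimes>\<^bsub>Z\<^esub> x)"
    using central[of x "\<iota> y"] by simp
  with xy show "x \<otimes>\<^bsub>Z\<^esub> y = y \<otimes>\<^bsub>Z\<^esub> x"
    by (meson Z.m_closed inj_onD iota_inj)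
qed

lemma section_exists: "\<exists>s. is_section E G \<pi> s"
  unfolding is_section_def
  by (rule exI[of _ "inv_into (carrier E) \<pi>"]) (auto simp: inv_into_into f_inv_into_f pi_surj)

lemma kernel_lift:
  assumes "e \<in> carrier E" "\<pi> e = \<one>\<^bsub>G\<^esub>"
  shows "inv_into (carrier Z) \<iota> e \<in> carrier Z" "\<iota> (inv_into (carrier Z) \<iota> e) = e"
proof -
  have "e \<in> \<iota> ` carrier Z" using assms exact by (auto simp: kernel_def)
  then show "inv_into (carrier Z) \<iota> e \<in> carrier Z" "\<iota> (inv_into (carrier Z) \<iota> e) = e"
    by (simp_all add: inv_into_into f_inv_into_f)
qed

lemma euler_cocycle_closed:
  assumes s: "is_section E G \<pi> s" and g: "g \<in> carrier G" and h: "h \<in> carrier G"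
  shows "euler_cocycle Z E G \<iota> s (g, h) \<in> carrier Z"
    and "\<iota> (euler_cocycle Z E G \<iota> s (g, h)) \<otimes>\<^bsub>E\<^esub> s (g \<otimes>\<^bsub>G\<^esub> h) = s g \<otimes>\<^bsub>E\<^esub> s h"
proof -
  have sc: "s x \<in> carrier E" "\<pi> (s x) = x" if "x \<in> carrier G" for x
    using s that by (auto simp: is_section_def)
  let ?e = "s g \<otimes>\<^bsub>E\<^esub> s h \<otimes>\<^bsub>E\<^esub> inv\<^bsub>E\<^esub> (s (g \<otimes>\<^bsub>G\<^esub> h))"
  have e: "?e \<in> carrier E" "\<pi> ?e = \<one>\<^bsub>G\<^esub>" using sc g h by simp_all
  have eq: "euler_cocycle Z E G \<iota> s (g, h) = inv_into (carrier Z) \<iota> ?e"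
    using g h by (simp add: euler_cocycle_def)
  show "euler_cocycle Z E G \<iota> s (g, h) \<in> carrier Z"
    using kernel_lift[OF e] by (simp add: eq)
  show "\<iota> (euler_cocycle Z E G \<iota> s (g, h)) \<otimes>\<^bsub>E\<^esub> s (g \<otimes>\<^bsub>G\<^esub> h) = s g \<otimes>\<^bsub>E\<^esub> s h"
    using kernel_lift[OF e] sc g h by (simp add: eq E.m_assoc)
qed

lemma euler_cocycle_in_cocycles2:
  assumes s: "is_section E G \<pi> s"
  shows "euler_cocycle Z E G \<iota> s \<in> cocycles2 G Z"
proof -
  let ?w = "euler_cocycle Z E G \<iota> s"
  have sc: "s x \<in> carrier E" if "x \<in> carrier G" for x
    using s that by (auto simp: is_section_def)
  note wc = euler_cocycle_closed(1)[OF s] and we = euler_cocycle_closed(2)[OF s]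
  have "?w (g, h) \<otimes>\<^bsub>Z\<^esub> ?w (g \<otimes>\<^bsub>G\<^esub> h, k) = ?w (h, k) \<otimes>\<^bsub>Z\<^esub> ?w (g, h \<otimes>\<^bsub>G\<^esub> k)"
    if g: "g \<in> carrier G" and h: "h \<in> carrier G" and k: "k \<in> carrier G" for g h k
  proof -
    let ?t = "s (g \<otimes>\<^bsub>G\<^esub> (h \<otimes>\<^bsub>G\<^esub> k))"
    have cl: "\<iota> (?w (g, h)) \<in> carrier E" "\<iota> (?w (g \<otimes>\<^bsub>G\<^esub> h, k)) \<in> carrier E"
      "\<iota> (?w (h, k)) \<in> carrier E" "\<iota> (?w (g, h \<otimes>\<^bsub>G\<^esub> k)) \<in> carrier E" "?t \<in> carrier E"
      using g h k wc sc by simp_all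
    have "\<iota> (?w (g, h)) \<otimes>\<^bsub>E\<^esub> (\<iota> (?w (g \<otimes>\<^bsub>G\<^esub> h, k)) \<otimes>\<^bsub>E\<^esub> ?t)
        = \<iota> (?w (g, h)) \<otimes>\<^bsub>E\<^esub> (s (g \<otimes>\<^bsub>G\<^esub> h) \<otimes>\<^bsub>E\<^esub> s k)"
      using we[of "g \<otimes>\<^bsub>G\<^esub> h" k] g h k by (simp add: G.m_assoc)
    also have "\<dots> = s g \<otimes>\<^bsub>E\<^esub> s h \<otimes>\<^bsub>E\<^esub> s k"
      using we[OF g h] g h k sc cl by (simp flip: E.m_assoc)
    also have "\<dots> = s g \<otimes>\<^bsub>E\<^esub> (\<iota> (?w (h, k)) \<otimes>\<^bsub>E\<^esub> s (h \<otimes>\<^bsub>G\<^esub> k))"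
      using we[OF h k] g h k sc by (simp add: E.m_assoc)
    also have "\<dots> = \<iota> (?w (h, k)) \<otimes>\<^bsub>E\<^esub> (s g \<otimes>\<^bsub>E\<^esub> s (h \<otimes>\<^bsub>G\<^esub> k))"
      using central[OF wc[OF h k] sc[OF g]] g h k sc cl by (simp flip: E.m_assoc)
    also have "\<dots> = \<iota> (?w (h, k)) \<otimes>\<^bsub>E\<^esub> (\<iota> (?w (g, h \<otimes>\<^bsub>G\<^esub> k)) \<otimes>\<^bsub>E\<^esub> ?t)"
      using we[of g "h \<otimes>\<^bsub>G\<^esub> k"] g h k by simp
    finally have "\<iota> (?w (g, h)) \<otimes>\<^bsub>E\<^esub> \<iota> (?w (g \<otimes>\<^bsub>G\<^esub> h, k))
        = \<iota> (?w (h, k)) \<otimes>\<^bsub>E\<^esub> \<iota> (?w (g, h \<otimes>\<^bsub>G\<^esub> k))"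
      using cl by (simp flip: E.m_assoc)
    then have "\<iota> (?w (g, h) \<otimes>\<^bsub>Z\<^esub> ?w (g \<otimes>\<^bsub>G\<^esub> h, k)) = \<iota> (?w (h, k) \<otimes>\<^bsub>Z\<^esub> ?w (g, h \<otimes>\<^bsub>G\<^esub> k))"
      using g h k wc by simp
    then show ?thesis
      using g h k wc by (meson G.m_closed Z.m_closed inj_onD iota_inj)
  qed
  moreover have "?w \<in> carrier (cochains2 G Z)"
  proof -
    have "?w \<in> extensional (carrier G \<times> carrier G)"
      by (simp add: euler_cocycle_def)
    then show ?thesis using wc by (auto simp: cochains2_def PiE_iff)
  qed
  ultimately show ?thesis by (auto simp: cocycles2_def)
qed

lemma group_cochains2: "group (cochains2 G Z)"
  by (simp add: cochains2_def Z.is_group)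

lemma coboundary1_in:
  "b \<in> carrier G \<rightarrow> carrier Z \<Longrightarrow> coboundary1 G Z b \<in> carrier (cochains2 G Z)"
  by (auto simp: coboundary1_def cochains2_def Pi_iff)

lemma subgroup_coboundaries2: "subgroup (coboundaries2 G Z) (cochains2 G Z)"
proof -
  interpret Z: comm_group Z by (rule Z_comm)
  interpret C: group "cochains2 G Z" by (rule group_cochains2)
  show ?thesis
  proof (rule C.subgroupI)
    show "coboundaries2 G Z \<subseteq> carrier (cochains2 G Z)"
      by (auto simp: coboundaries2_def coboundary1_in)
    show "coboundaries2 G Z \<noteq> {}"
      using Z.one_closed by (auto simp: coboundaries2_def)
  next
    fix a assume "a \<in> coboundaries2 G Z"
    then obtain b where b: "b \<in> carrier G \<rightarrow> carrier Z" and a: "a = coboundary1 G Z b"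
      by (auto simp: coboundaries2_def)
    have bc: "b x \<in> carrier Z" if "x \<in> carrier G" for x using b that by auto
    have cancel: "inv\<^bsub>Z\<^esub> x \<otimes>\<^bsub>Z\<^esub> inv\<^bsub>Z\<^esub> y \<otimes>\<^bsub>Z\<^esub> z \<otimes>\<^bsub>Z\<^esub> (x \<otimes>\<^bsub>Z\<^esub> y \<otimes>\<^bsub>Z\<^esub> inv\<^bsub>Z\<^esub> z) = \<one>\<^bsub>Z\<^esub>"
      if x: "x \<in> carrier Z" and y: "y \<in> carrier Z" and z: "z \<in> carrier Z" for x y z
    proof -
      have "inv\<^bsub>Z\<^esub> x \<otimes>\<^bsub>Z\<^esub> inv\<^bsub>Z\<^esub> y \<otimes>\<^bsub>Z\<^esub> z = inv\<^bsub>Z\<^esub> (x \<otimes>\<^bsub>Z\<^esub> y \<otimes>\<^bsub>Z\<^esub> inv\<^bsub>Z\<^esub> z)"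
        using x y z by (simp add: Z.inv_mult)
      then show ?thesis using x y z by simp
    qed
    have "inv\<^bsub>cochains2 G Z\<^esub> a = coboundary1 G Z (\<lambda>g. inv\<^bsub>Z\<^esub> (b g))"
    proof -
      have "coboundary1 G Z (\<lambda>g. inv\<^bsub>Z\<^esub> (b g)) \<otimes>\<^bsub>cochains2 G Z\<^esub> a = \<one>\<^bsub>cochains2 G Z\<^esub>"
        using bc by (auto simp: a coboundary1_def cochains2_def cancel intro!: restrict_ext)
      then show ?thesis
        using C.inv_equality coboundary1_in[OF b] coboundary1_in[of "\<lambda>g. inv\<^bsub>Z\<^esub> (b g)"] bc a
        by auto
    qed
    then show "inv\<^bsub>cochains2 G Z\<^esub> a \<in> coboundaries2 G Z"
      using bc by (auto simp: coboundaries2_def)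
  next
    fix a a' assume "a \<in> coboundaries2 G Z" "a' \<in> coboundaries2 G Z"
    then obtain b b' where b: "b \<in> carrier G \<rightarrow> carrier Z" "a = coboundary1 G Z b"
      and b': "b' \<in> carrier G \<rightarrow> carrier Z" "a' = coboundary1 G Z b'"
      by (auto simp: coboundaries2_def)
    have bc: "b x \<in> carrier Z" "b' x \<in> carrier Z" if "x \<in> carrier G" for x
      using b b' that by auto
    have "a \<otimes>\<^bsub>cochains2 G Z\<^esub> a' = coboundary1 G Z (\<lambda>g. b g \<otimes>\<^bsub>Z\<^esub> b' g)"
      using bc by (auto simp: b b' coboundary1_def cochains2_def Z.inv_mult Z.m_ac
          intro!: restrict_ext)
    then show "a \<otimes>\<^bsub>cochains2 G Z\<^esub> a' \<in> coboundaries2 G Z"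
      using bc by (auto simp: coboundaries2_def)
  qed
qed

lemma cohomology_class_section_indep:
  assumes s: "is_section E G \<pi> s" and t: "is_section E G \<pi> t"
  shows "cohomology_class G Z (euler_cocycle Z E G \<iota> s)
       = cohomology_class G Z (euler_cocycle Z E G \<iota> t)"
proof -
  interpret Z: comm_group Z by (rule Z_comm)
  interpret C: group "cochains2 G Z" by (rule group_cochains2)
  let ?w = "euler_cocycle Z E G \<iota> s" and ?v = "euler_cocycle Z E G \<iota> t"
  have sc: "s x \<in> carrier E" "t x \<in> carrier E" "\<pi> (s x) = x" "\<pi> (t x) = x"
    if "x \<in> carrier G" for x
    using s t that by (auto simp: is_section_def)
  define b where "b g = inv_into (carrier Z) \<iota> (t g \<otimes>\<^bsub>E\<^esub> inv\<^bsub>E\<^esub> (s g))" for g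
  have b: "b g \<in> carrier Z" "\<iota> (b g) \<otimes>\<^bsub>E\<^esub> s g = t g" if "g \<in> carrier G" for g
    using kernel_lift[of "t g \<otimes>\<^bsub>E\<^esub> inv\<^bsub>E\<^esub> (s g)"] sc[OF that] that
    by (simp_all add: b_def E.m_assoc)
  note wc = euler_cocycle_closed(1)[OF s] and we = euler_cocycle_closed(2)[OF s]
  note vc = euler_cocycle_closed(1)[OF t] and ve = euler_cocycle_closed(2)[OF t]
  have *: "?v (g, h) \<otimes>\<^bsub>Z\<^esub> b (g \<otimes>\<^bsub>G\<^esub> h) = b g \<otimes>\<^bsub>Z\<^esub> b h \<otimes>\<^bsub>Z\<^esub> ?w (g, h)"
    if g: "g \<in> carrier G" and h: "h \<in> carrier G" for g h
  proof -
    let ?u = "s (g \<otimes>\<^bsub>G\<^esub> h)"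
    have cl: "\<iota> (?w (g, h)) \<in> carrier E" "\<iota> (?v (g, h)) \<in> carrier E" "\<iota> (b g) \<in> carrier E"
      "\<iota> (b h) \<in> carrier E" "\<iota> (b (g \<otimes>\<^bsub>G\<^esub> h)) \<in> carrier E" "?u \<in> carrier E"
      using g h wc vc b sc by simp_all
    have "\<iota> (?v (g, h)) \<otimes>\<^bsub>E\<^esub> \<iota> (b (g \<otimes>\<^bsub>G\<^esub> h)) \<otimes>\<^bsub>E\<^esub> ?u = t g \<otimes>\<^bsub>E\<^esub> t h"
      using ve[OF g h] b(2)[of "g \<otimes>\<^bsub>G\<^esub> h"] g h cl by (simp add: E.m_assoc)
    also have "\<dots> = \<iota> (b g) \<otimes>\<^bsub>E\<^esub> (s g \<otimes>\<^bsub>E\<^esub> \<iota> (b h)) \<otimes>\<^bsub>E\<^esub> s h"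
      using b(2)[OF g, symmetric] b(2)[OF h, symmetric] g h sc cl by (simp add: E.m_assoc)
    also have "\<dots> = \<iota> (b g) \<otimes>\<^bsub>E\<^esub> \<iota> (b h) \<otimes>\<^bsub>E\<^esub> (s g \<otimes>\<^bsub>E\<^esub> s h)"
      using central[OF b(1)[OF h] sc(1)[OF g], symmetric] g h sc cl by (simp add: E.m_assoc)
    also have "\<dots> = \<iota> (b g) \<otimes>\<^bsub>E\<^esub> \<iota> (b h) \<otimes>\<^bsub>E\<^esub> \<iota> (?w (g, h)) \<otimes>\<^bsub>E\<^esub> ?u"
      using we[OF g h, symmetric] g h cl by (simp add: E.m_assoc)
    finally have "\<iota> (?v (g, h) \<otimes>\<^bsub>Z\<^esub> b (g \<otimes>\<^bsub>G\<^esub> h)) = \<iota> (b g \<otimes>\<^bsub>Z\<^esub> b h \<otimes>\<^bsub>Z\<^esub> ?w (g, h))"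
      using cl g h b(1) wc vc by simp
    then show ?thesis
      using g h b(1) wc vc by (meson G.m_closed Z.m_closed inj_onD iota_inj)
  qed
  have w: "?w \<in> carrier (cochains2 G Z)" and v: "?v \<in> carrier (cochains2 G Z)"
    using euler_cocycle_in_cocycles2[OF s] euler_cocycle_in_cocycles2[OF t]
    by (auto simp: cocycles2_def)
  have "?v = coboundary1 G Z b \<otimes>\<^bsub>cochains2 G Z\<^esub> ?w"
  proof (rule extensionalityI[of _ "carrier G \<times> carrier G"])
    show "?v \<in> extensional (carrier G \<times> carrier G)"
      using v by (auto simp: cochains2_def PiE_iff)
    show "coboundary1 G Z b \<otimes>\<^bsub>cochains2 G Z\<^esub> ?w \<in> extensional (carrier G \<times> carrier G)"
      by (simp add: cochains2_def)
    fix p assume "p \<in> carrier G \<times> carrier G"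
    then obtain g h where p: "p = (g, h)" and g: "g \<in> carrier G" and h: "h \<in> carrier G" by auto
    have "?v (g, h) = b g \<otimes>\<^bsub>Z\<^esub> b h \<otimes>\<^bsub>Z\<^esub> ?w (g, h) \<otimes>\<^bsub>Z\<^esub> inv\<^bsub>Z\<^esub> (b (g \<otimes>\<^bsub>G\<^esub> h))"
      using Z.inv_solve_right[of "?v (g, h)" "b g \<otimes>\<^bsub>Z\<^esub> b h \<otimes>\<^bsub>Z\<^esub> ?w (g, h)" "b (g \<otimes>\<^bsub>G\<^esub> h)"]
        *[OF g h] g h b(1) wc vc by simp
    then show "?v p = (coboundary1 G Z b \<otimes>\<^bsub>cochains2 G Z\<^esub> ?w) p"
      using g h b(1) wc by (simp add: p coboundary1_def cochains2_def Z.m_ac)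
  qed
  then have "?v \<in> coboundaries2 G Z #>\<^bsub>cochains2 G Z\<^esub> ?w"
    using b(1) by (auto simp: r_coset_def coboundaries2_def)
  then show ?thesis
    using C.repr_independence[OF _ w subgroup_coboundaries2] by (simp add: cohomology_class_def)
qed

lemma euler_class_eq:
  assumes "is_section E G \<pi> s"
  shows "euler_class Z E G \<iota> \<pi> = cohomology_class G Z (euler_cocycle Z E G \<iota> s)"
  unfolding euler_class_def
  by (rule cohomology_class_section_indep[OF someI_ex[OF section_exists] assms])

lemma euler_class_in_H2: "euler_class Z E G \<iota> \<pi> \<in> carrier (H2 G Z)"
proof -
  obtain s where s: "is_section E G \<pi> s" using section_exists by blast
  show ?thesis
    unfolding euler_class_eq[OF s]
    using euler_cocycle_in_cocycles2[OF s]
    by (auto simp: H2_def FactGroup_def RCOSETS_def cohomology_class_def r_coset_def)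
qed

end


section \<open>Quasi-homomorphisms, quasi-splittings, quasi-retractions\<close>

definition quasi_hom ::
  "('a, 'm) monoid_scheme \<Rightarrow> ('b, 'n) monoid_scheme \<Rightarrow> ('a \<Rightarrow> 'b) \<Rightarrow> bool" where
  "quasi_hom A B \<phi> \<longleftrightarrow> \<phi> \<in> carrier A \<rightarrow> carrier B \<and>
     finite {inv\<^bsub>B\<^esub> (\<phi> h) \<otimes>\<^bsub>B\<^esub> inv\<^bsub>B\<^esub> (\<phi> g) \<otimes>\<^bsub>B\<^esub> \<phi> (g \<otimes>\<^bsub>A\<^esub> h) | g h.
       g \<in> carrier A \<and> h \<in> carrier A}"

definition quasi_splits ::
  "('e, 'n) monoid_scheme \<Rightarrow> ('g, 'k) monoid_scheme \<Rightarrow> ('e \<Rightarrow> 'g) \<Rightarrow> bool" where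
  "quasi_splits E G \<pi> \<longleftrightarrow>
     (\<exists>s. is_section E G \<pi> s \<and> s \<one>\<^bsub>G\<^esub> = \<one>\<^bsub>E\<^esub> \<and> quasi_hom G E s)"

text \<open>Quasi-splitting of an extension only refers to its projection; that the restricted sequence
  is again a central extension is \<open>central_extension_restrict\<close> below.\<close>

definition virtually_quasi_splits ::
  "('e, 'n) monoid_scheme \<Rightarrow> ('g, 'k) monoid_scheme \<Rightarrow> ('e \<Rightarrow> 'g) \<Rightarrow> bool" where
  "virtually_quasi_splits E G \<pi> \<longleftrightarrow>
     (\<exists>E'. subgroup E' E \<and> finite (rcosets\<^bsub>E\<^esub> E') \<and>
        quasi_splits (E\<lparr>carrier := E'\<rparr>) (G\<lparr>carrier := \<pi> ` E'\<rparr>) \<pi>)"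

definition quasi_retraction ::
  "('z, 'm) monoid_scheme \<Rightarrow> ('e, 'n) monoid_scheme \<Rightarrow> ('z \<Rightarrow> 'e) \<Rightarrow> ('e \<Rightarrow> 'z) \<Rightarrow> bool" where
  "quasi_retraction Z E \<iota> \<phi> \<longleftrightarrow> quasi_hom E Z \<phi> \<and> (\<forall>z\<in>carrier Z. \<phi> (\<iota> z) = z)"

lemma (in central_extension) central_extension_restrict:
  assumes E': "subgroup E' E"
  shows "central_extension (Z\<lparr>carrier := {z \<in> carrier Z. \<iota> z \<in> E'}\<rparr>) (E\<lparr>carrier := E'\<rparr>)
           (G\<lparr>carrier := \<pi> ` E'\<rparr>) \<iota> \<pi>"
proof -
  interpret E': subgroup E' E by (rule E')
  have 1: "subgroup {z \<in> carrier Z. \<iota> z \<in> E'} Z"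
  proof (rule Z.subgroupI)
    have "\<one>\<^bsub>Z\<^esub> \<in> {z \<in> carrier Z. \<iota> z \<in> E'}" by simp
    then show "{z \<in> carrier Z. \<iota> z \<in> E'} \<noteq> {}" by blast
  qed auto
  have 2: "subgroup (\<pi> ` E') G"
    by (rule pi.subgroup_img_is_subgroup[OF E'])
  have 3: "E' \<subseteq> carrier E" by (rule E'.subset)
  show ?thesis
  proof (intro central_extension.intro central_extension_axioms.intro)
    show "group (Z\<lparr>carrier := {z \<in> carrier Z. \<iota> z \<in> E'}\<rparr>)"
      by (rule Z.subgroup_imp_group[OF 1])
    show "group (E\<lparr>carrier := E'\<rparr>)" by (rule E.subgroup_imp_group[OF E'])
    show "group (G\<lparr>carrier := \<pi> ` E'\<rparr>)" by (rule G.subgroup_imp_group[OF 2])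
    show "inj_on \<iota> (carrier (Z\<lparr>carrier := {z \<in> carrier Z. \<iota> z \<in> E'}\<rparr>))"
      using iota_inj by (auto intro: inj_on_subset)
    show "kernel (E\<lparr>carrier := E'\<rparr>) (G\<lparr>carrier := \<pi> ` E'\<rparr>) \<pi>
        = \<iota> ` carrier (Z\<lparr>carrier := {z \<in> carrier Z. \<iota> z \<in> E'}\<rparr>)"
    proof -
      have "kernel (E\<lparr>carrier := E'\<rparr>) (G\<lparr>carrier := \<pi> ` E'\<rparr>) \<pi> = kernel E G \<pi> \<inter> E'"
        using 3 by (auto simp: kernel_def)
      then show ?thesis using exact by auto
    qed
    show "\<iota> \<in> hom (Z\<lparr>carrier := {z \<in> carrier Z. \<iota> z \<in> E'}\<rparr>) (E\<lparr>carrier := E'\<rparr>)"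
      by (simp add: hom_def)
    show "\<pi> \<in> hom (E\<lparr>carrier := E'\<rparr>) (G\<lparr>carrier := \<pi> ` E'\<rparr>)"
      using 3 by (simp add: hom_def subset_iff)
    show "\<pi> ` carrier (E\<lparr>carrier := E'\<rparr>) = carrier (G\<lparr>carrier := \<pi> ` E'\<rparr>)"
      by simp
  qed (use 3 central in \<open>simp add: subset_iff\<close>)
qed


section \<open>Quasi-lines and the Gromov boundary\<close>

definition quasi_isometric :: "'a metric \<Rightarrow> 'b metric \<Rightarrow> bool" where
  "quasi_isometric M N \<longleftrightarrow> (\<exists>f K C. f \<in> mspace M \<rightarrow> mspace N \<and> K \<ge> 1 \<and> C \<ge> 0 \<and>
     (\<forall>x\<in>mspace M. \<forall>y\<in>mspace M.
        mdist M x y / K - C \<le> mdist N (f x) (f y) \<and> mdist N (f x) (f y) \<le> K * mdist M x y + C) \<and>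
     (\<forall>y\<in>mspace N. \<exists>x\<in>mspace M. mdist N y (f x) \<le> C))"

definition path_length :: "'a metric \<Rightarrow> (real \<Rightarrow> 'a) \<Rightarrow> ennreal" where
  "path_length M \<gamma> =
     (SUP (n, t) \<in> {(n, t :: nat \<Rightarrow> real). mono_on {..n} t \<and> t 0 = 0 \<and> t n = 1}.
        ennreal (\<Sum>i<n. mdist M (\<gamma> (t i)) (\<gamma> (t (Suc i)))))"

definition is_path_metric :: "'a metric \<Rightarrow> bool" where
  "is_path_metric M \<longleftrightarrow> (\<forall>x\<in>mspace M. \<forall>y\<in>mspace M.
     ennreal (mdist M x y) =
       (INF \<gamma>\<in>{\<gamma>. pathin (mtopology_of M) \<gamma> \<and> \<gamma> 0 = x \<and> \<gamma> 1 = y}. path_length M \<gamma>))"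

definition quasi_line :: "'a metric \<Rightarrow> bool" where
  "quasi_line M \<longleftrightarrow> is_path_metric M \<and> quasi_isometric M (euclidean_metric :: real metric)"

definition gromov_product :: "'a metric \<Rightarrow> 'a \<Rightarrow> 'a \<Rightarrow> 'a \<Rightarrow> real" where
  "gromov_product M p x y = (mdist M x p + mdist M y p - mdist M x y) / 2"

definition gromov_hyperbolic :: "'a metric \<Rightarrow> bool" where
  "gromov_hyperbolic M \<longleftrightarrow>
     (\<exists>\<delta>\<ge>0. \<forall>p\<in>mspace M. \<forall>x\<in>mspace M. \<forall>y\<in>mspace M. \<forall>z\<in>mspace M.
        gromov_product M p x z \<ge> min (gromov_product M p x y) (gromov_product M p y z) - \<delta>)"

text \<open>The sequential boundary: sequences with \<open>(x\<^sub>i | x\<^sub>j)\<^sub>p \<rightarrow> \<infinity>\<close>, where \<open>x\<close> and \<open>y\<close> are identified if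
  \<open>(x\<^sub>i | y\<^sub>j)\<^sub>p \<rightarrow> \<infinity>\<close> (as \<open>i, j \<rightarrow> \<infinity>\<close>). These conditions do not depend on the base point \<open>p\<close>.\<close>

definition gromov_product_to_infinity ::
  "'a metric \<Rightarrow> (nat \<Rightarrow> 'a) \<Rightarrow> (nat \<Rightarrow> 'a) \<Rightarrow> bool" where
  "gromov_product_to_infinity M x y \<longleftrightarrow> (\<forall>p\<in>mspace M.
     filterlim (\<lambda>(i, j). gromov_product M p (x i) (y j)) at_top (sequentially \<times>\<^sub>F sequentially))"

definition boundary_sequences :: "'a metric \<Rightarrow> (nat \<Rightarrow> 'a) set" where
  "boundary_sequences M = {x. range x \<subseteq> mspace M \<and> gromov_product_to_infinity M x x}"

definition boundary_rel :: "'a metric \<Rightarrow> ((nat \<Rightarrow> 'a) \<times> (nat \<Rightarrow> 'a)) set" where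
  "boundary_rel M = {(x, y). x \<in> boundary_sequences M \<and> y \<in> boundary_sequences M \<and>
     gromov_product_to_infinity M x y}"

definition gromov_boundary :: "'a metric \<Rightarrow> (nat \<Rightarrow> 'a) set set" where
  "gromov_boundary M = boundary_sequences M // boundary_rel M"

definition boundary_map :: "('a \<Rightarrow> 'a) \<Rightarrow> (nat \<Rightarrow> 'a) set \<Rightarrow> (nat \<Rightarrow> 'a) set" where
  "boundary_map f \<xi> = (\<lambda>x. f \<circ> x) ` \<xi>"


section \<open>Isometric actions\<close>

definition isometric_action ::
  "('g, 'k) monoid_scheme \<Rightarrow> 'a metric \<Rightarrow> ('g \<Rightarrow> 'a \<Rightarrow> 'a) \<Rightarrow> bool" where
  "isometric_action G M \<phi> \<longleftrightarrow> group_action G (mspace M) \<phi> \<and>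
     (\<forall>g\<in>carrier G. \<forall>x\<in>mspace M. \<forall>y\<in>mspace M. mdist M (\<phi> g x) (\<phi> g y) = mdist M x y)"

definition elliptic ::
  "('g, 'k) monoid_scheme \<Rightarrow> 'a metric \<Rightarrow> ('g \<Rightarrow> 'a \<Rightarrow> 'a) \<Rightarrow> 'g \<Rightarrow> bool" where
  "elliptic G M \<phi> g \<longleftrightarrow> (\<exists>x\<in>mspace M.
     Metric_space.mbounded (mspace M) (mdist M) {\<phi> (g [^]\<^bsub>G\<^esub> n) x | n :: int. True})"

definition boundary_fixpoints :: "'a metric \<Rightarrow> ('a \<Rightarrow> 'a) \<Rightarrow> (nat \<Rightarrow> 'a) set set" where
  "boundary_fixpoints M f = {\<xi> \<in> gromov_boundary M. boundary_map f \<xi> = \<xi>}"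

definition loxodromic ::
  "('g, 'k) monoid_scheme \<Rightarrow> 'a metric \<Rightarrow> ('g \<Rightarrow> 'a \<Rightarrow> 'a) \<Rightarrow> 'g \<Rightarrow> bool" where
  "loxodromic G M \<phi> g \<longleftrightarrow> \<not> elliptic G M \<phi> g \<and> card (boundary_fixpoints M (\<phi> g)) = 2"

definition lineal_action ::
  "('g, 'k) monoid_scheme \<Rightarrow> 'a metric \<Rightarrow> ('g \<Rightarrow> 'a \<Rightarrow> 'a) \<Rightarrow> bool" where
  "lineal_action G M \<phi> \<longleftrightarrow> gromov_hyperbolic M \<and> isometric_action G M \<phi> \<and>
     (\<exists>g\<in>carrier G. loxodromic G M \<phi> g) \<and>
     (\<forall>g\<in>carrier G. \<forall>h\<in>carrier G. loxodromic G M \<phi> g \<longrightarrow> loxodromic G M \<phi> h \<longrightarrow>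
        boundary_fixpoints M (\<phi> g) = boundary_fixpoints M (\<phi> h))"

definition limit_points ::
  "('g, 'k) monoid_scheme \<Rightarrow> 'a metric \<Rightarrow> ('g \<Rightarrow> 'a \<Rightarrow> 'a) \<Rightarrow> (nat \<Rightarrow> 'a) set set" where
  "limit_points G M \<phi> = {\<xi> \<in> gromov_boundary M.
     \<exists>x\<in>mspace M. \<exists>g. range g \<subseteq> carrier G \<and> (\<lambda>n :: nat. \<phi> (g n) x) \<in> \<xi>}"

definition orientable_lineal_action ::
  "('g, 'k) monoid_scheme \<Rightarrow> 'a metric \<Rightarrow> ('g \<Rightarrow> 'a \<Rightarrow> 'a) \<Rightarrow> bool" where
  "orientable_lineal_action G M \<phi> \<longleftrightarrow> lineal_action G M \<phi> \<and>
     \<not> (\<exists>g\<in>carrier G. \<exists>\<xi>\<in>limit_points G M \<phi>. \<exists>\<eta>\<in>limit_points G M \<phi>.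
          \<xi> \<noteq> \<eta> \<and> boundary_map (\<phi> g) \<xi> = \<eta> \<and> boundary_map (\<phi> g) \<eta> = \<xi>)"

definition proper_action ::
  "('g, 'k) monoid_scheme \<Rightarrow> 'a metric \<Rightarrow> ('g \<Rightarrow> 'a \<Rightarrow> 'a) \<Rightarrow> bool" where
  "proper_action G M \<phi> \<longleftrightarrow>
     (\<forall>x\<in>mspace M. \<forall>R>0. finite {g \<in> carrier G. mdist M x (\<phi> g x) \<le> R})"

definition cobounded_action ::
  "('g, 'k) monoid_scheme \<Rightarrow> 'a metric \<Rightarrow> ('g \<Rightarrow> 'a \<Rightarrow> 'a) \<Rightarrow> bool" where
  "cobounded_action G M \<phi> \<longleftrightarrow>
     (\<exists>x\<in>mspace M. \<exists>\<epsilon>\<ge>0. \<forall>y\<in>mspace M. \<exists>g\<in>carrier G. mdist M y (\<phi> g x) \<le> \<epsilon>)"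

definition geometric_action ::
  "('g, 'k) monoid_scheme \<Rightarrow> 'a metric \<Rightarrow> ('g \<Rightarrow> 'a \<Rightarrow> 'a) \<Rightarrow> bool" where
  "geometric_action G M \<phi> \<longleftrightarrow>
     isometric_action G M \<phi> \<and> proper_action G M \<phi> \<and> cobounded_action G M \<phi>"


section \<open>Finite products with the \<open>\<ell>\<^sup>1\<close>-metric\<close>

definition l1_product :: "nat \<Rightarrow> (nat \<Rightarrow> 'a metric) \<Rightarrow> (nat \<Rightarrow> 'a) metric" where
  "l1_product r L =
     metric (\<Pi>\<^sub>E i\<in>{..<r}. mspace (L i), \<lambda>x y. \<Sum>i<r. mdist (L i) (x i) (y i))"

lemma Metric_space_l1_product:
  fixes L :: "nat \<Rightarrow> 'a metric"
  shows "Metric_space (\<Pi>\<^sub>E i\<in>{..<r}. mspace (L i)) (\<lambda>x y. \<Sum>i<r. mdist (L i) (x i) (y i))"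
proof
  fix x y z
  show "0 \<le> (\<Sum>i<r. mdist (L i) (x i) (y i))" by (simp add: sum_nonneg)
  show "(\<Sum>i<r. mdist (L i) (x i) (y i)) = (\<Sum>i<r. mdist (L i) (y i) (x i))"
    by (simp add: mdist_commute)
  assume x: "x \<in> (\<Pi>\<^sub>E i\<in>{..<r}. mspace (L i))" and y: "y \<in> (\<Pi>\<^sub>E i\<in>{..<r}. mspace (L i))"
  show "((\<Sum>i<r. mdist (L i) (x i) (y i)) = 0) = (x = y)"
  proof
    assume "(\<Sum>i<r. mdist (L i) (x i) (y i)) = 0"
    then have "mdist (L i) (x i) (y i) = 0" if "i < r" for i
      using that sum_nonneg_eq_0_iff[of "{..<r}" "\<lambda>i. mdist (L i) (x i) (y i)"] by simp
    then have "x i = y i" if "i < r" for i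
      using x y that by (metis PiE_mem lessThan_iff mdist_zero)
    then show "x = y" using x y by (auto intro: PiE_ext)
  next
    assume "x = y"
    then show "(\<Sum>i<r. mdist (L i) (x i) (y i)) = 0"
      using y by (intro sum.neutral) (auto simp: PiE_iff)
  qed
  assume z: "z \<in> (\<Pi>\<^sub>E i\<in>{..<r}. mspace (L i))"
  show "(\<Sum>i<r. mdist (L i) (x i) (z i))
      \<le> (\<Sum>i<r. mdist (L i) (x i) (y i)) + (\<Sum>i<r. mdist (L i) (y i) (z i))"
    unfolding sum.distrib[symmetric]
    using x y z by (intro sum_mono mdist_triangle) (auto simp: PiE_iff)
qed

lemma mspace_l1_product [simp]: "mspace (l1_product r L) = (\<Pi>\<^sub>E i\<in>{..<r}. mspace (L i))"
  by (simp add: l1_product_def Metric_space.mspace_metric Metric_space_l1_product)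

lemma mdist_l1_product [simp]:
  "mdist (l1_product r L) = (\<lambda>x y. \<Sum>i<r. mdist (L i) (x i) (y i))"
  by (simp add: l1_product_def Metric_space.mdist_metric Metric_space_l1_product)

definition diagonal_action :: "nat \<Rightarrow> (nat \<Rightarrow> 'g \<Rightarrow> 'a \<Rightarrow> 'a) \<Rightarrow> (nat \<Rightarrow> 'a metric) \<Rightarrow>
  'g \<Rightarrow> (nat \<Rightarrow> 'a) \<Rightarrow> nat \<Rightarrow> 'a" where
  "diagonal_action r a L g =
     (\<lambda>x\<in>(\<Pi>\<^sub>E i\<in>{..<r}. mspace (L i)). \<lambda>i\<in>{..<r}. a i g (x i))"


section \<open>Equivalence of a list of statements\<close>

definition all_equivalent :: "bool list \<Rightarrow> bool" where
  "all_equivalent Ps \<longleftrightarrow> (\<forall>P\<in>set Ps. \<forall>Q\<in>set Ps. P \<longleftrightarrow> Q)"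

end

theory Submission
  imports Defs
begin

text \<open>A quasi-retraction \<open>\<phi>\<close> and a quasi-homomorphic section \<open>s\<close> determine each other through
  \<open>e = \<phi>(e) s(\<pi>(e))\<close>, up to bounded error, and the defect of \<open>s\<close> is the Euler cocycle. For a
  finite-index subgroup \<open>E'\<close> the coordinates of a quasi-retraction of \<open>E'\<close> are averaged over the
  cosets of \<open>E'\<close>, as in the transfer, to real quasimorphisms on \<open>E\<close> that are close to the
  coordinates of \<open>Z\<close>; rounding them gives a quasi-retraction of \<open>E\<close>. Each coordinate of a
  quasi-retraction is a quasimorphism \<open>\<beta>\<close> on \<open>E\<close>, and \<open>E\<close> acts by translation on the convex
  set of real functions on \<open>E\<close> that are almost \<open>\<beta>\<close>-equivariant, which is a quasi-line.
  Conversely, if \<open>E\<close> acts isometrically and \<open>Z\<close> geometrically on the same space, approximating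
  the orbit map of \<open>E\<close> by that of \<open>Z\<close> yields a quasi-retraction, because \<open>Z\<close> is central.\<close>

section \<open>Bounded Euler classes, quasi-splittings and quasi-retractions\<close>

text \<open>All conditions are compared with the existence of a quasi-retraction. Finiteness in
  \<open>Z\<close> is tested on r integer coordinates: a subset is finite iff these are bounded on
  it, so the torsion part contributes only finite fibres, and quasi-homomorphisms into
  \<open>Z\<close> become real quasimorphisms. The recurring obstacle is that a quasi-retraction
  must be exactly the identity on \<open>Z\<close>, whereas rounding and orbit approximation only
  come close to it; such maps are overwritten on the image of \<open>Z\<close>, a bounded change
  that the defect tolerates. Averages over cosets leave the integers because a sum would restrict to
  a multiple of the coordinates, namely by the index. The function space replaces the Cayley graph
  for an infinite generating set that usually realises a quasimorphism as a quasi-line: it differs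
  from the real line by an additive error only, so its Gromov products and its boundary can be
  computed directly.\<close>

context central_extension
begin

lemma iota_eq_iff: "x \<in> carrier Z \<Longrightarrow> y \<in> carrier Z \<Longrightarrow> \<iota> x = \<iota> y \<longleftrightarrow> x = y"
  using iota_inj by (auto dest: inj_onD)

lemma kernel_cases:
  assumes "e \<in> carrier E" "\<pi> e = \<one>\<^bsub>G\<^esub>"
  obtains z where "z \<in> carrier Z" "e = \<iota> z"
  using kernel_lift[OF assms] by metis

lemma pi_iota [simp]: "z \<in> carrier Z \<Longrightarrow> \<pi> (\<iota> z) = \<one>\<^bsub>G\<^esub>"
  using exact by (auto simp: kernel_def)

lemma sectionD:
  assumes "is_section E G \<pi> s" "g \<in> carrier G"
  shows "s g \<in> carrier E" "\<pi> (s g) = g"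
  using assms by (auto simp: is_section_def)

lemma euler_cocycle_eqI:
  assumes s: "is_section E G \<pi> s" and gh: "g \<in> carrier G" "h \<in> carrier G" and c: "c \<in> carrier Z"
    and eq: "s g \<otimes>\<^bsub>E\<^esub> s h = \<iota> c \<otimes>\<^bsub>E\<^esub> s (g \<otimes>\<^bsub>G\<^esub> h)"
  shows "euler_cocycle Z E G \<iota> s (g, h) = c"
proof -
  note w = euler_cocycle_closed[OF s gh]
  have "\<iota> (euler_cocycle Z E G \<iota> s (g, h)) = \<iota> c"
    using w eq sectionD(1)[OF s, of "g \<otimes>\<^bsub>G\<^esub> h"] gh c by simp
  then show ?thesis using w c iota_eq_iff by blast
qed

lemma section_shift:
  assumes s: "is_section E G \<pi> s" and b: "b \<in> carrier G \<rightarrow> carrier Z"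
  shows "is_section E G \<pi> (\<lambda>g. \<iota> (b g) \<otimes>\<^bsub>E\<^esub> s g)"
  using sectionD[OF s] b by (auto simp: is_section_def Pi_iff)

text \<open>The values of \<open>b\<close> are central, so they can be collected in front of
  \<open>s g\<close> and \<open>s h\<close>. The purpose: every representative of the Euler class is
  itself the Euler cocycle of some section, so boundedness of the class can be read off a single
  section.\<close>

lemma euler_cocycle_shift:
  assumes s: "is_section E G \<pi> s" and b: "b \<in> carrier G \<rightarrow> carrier Z"
    and g: "g \<in> carrier G" and h: "h \<in> carrier G"
  shows "euler_cocycle Z E G \<iota> (\<lambda>g. \<iota> (b g) \<otimes>\<^bsub>E\<^esub> s g) (g, h) =
    coboundary1 G Z b (g, h) \<otimes>\<^bsub>Z\<^esub> euler_cocycle Z E G \<iota> s (g, h)" (is "_ = ?c \<otimes>\<^bsub>Z\<^esub> ?w")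
proof (rule euler_cocycle_eqI[OF section_shift[OF s b] g h])
  interpret Z: comm_group Z by (rule Z_comm)
  have bc: "b x \<in> carrier Z" if "x \<in> carrier G" for x using b that by auto
  note bgh = bc[OF g] bc[OF h] bc[of "g \<otimes>\<^bsub>G\<^esub> h"]
  note w = euler_cocycle_closed[OF s g h]
  note sc = sectionD(1)[OF s]
  show "?c \<otimes>\<^bsub>Z\<^esub> ?w \<in> carrier Z" using bgh g h w by (simp add: coboundary1_def)
  have "x \<otimes>\<^bsub>Z\<^esub> inv\<^bsub>Z\<^esub> y \<otimes>\<^bsub>Z\<^esub> z \<otimes>\<^bsub>Z\<^esub> y = x \<otimes>\<^bsub>Z\<^esub> z"
    if xyz: "x \<in> carrier Z" "y \<in> carrier Z" "z \<in> carrier Z" for x y z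
  proof -
    have "inv\<^bsub>Z\<^esub> y \<otimes>\<^bsub>Z\<^esub> (z \<otimes>\<^bsub>Z\<^esub> y) = z"
      using xyz unfolding Z.m_comm[OF xyz(3,2)] by (simp flip: Z.m_assoc)
    then show ?thesis using xyz by (simp add: Z.m_assoc)
  qed
  then have "?c \<otimes>\<^bsub>Z\<^esub> ?w \<otimes>\<^bsub>Z\<^esub> b (g \<otimes>\<^bsub>G\<^esub> h) = b g \<otimes>\<^bsub>Z\<^esub> b h \<otimes>\<^bsub>Z\<^esub> ?w"
    using bgh g h w(1) by (simp add: coboundary1_def)
  then have e: "\<iota> (?c \<otimes>\<^bsub>Z\<^esub> ?w) \<otimes>\<^bsub>E\<^esub> \<iota> (b (g \<otimes>\<^bsub>G\<^esub> h)) = \<iota> (b g) \<otimes>\<^bsub>E\<^esub> \<iota> (b h) \<otimes>\<^bsub>E\<^esub> \<iota> ?w"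
    using bgh g h w \<open>?c \<otimes>\<^bsub>Z\<^esub> ?w \<in> carrier Z\<close>
    by (metis G.m_closed Z.m_closed iota.hom_mult)
  have "\<iota> (b g) \<otimes>\<^bsub>E\<^esub> s g \<otimes>\<^bsub>E\<^esub> (\<iota> (b h) \<otimes>\<^bsub>E\<^esub> s h) = \<iota> (b g) \<otimes>\<^bsub>E\<^esub> (s g \<otimes>\<^bsub>E\<^esub> \<iota> (b h)) \<otimes>\<^bsub>E\<^esub> s h"
    using bgh g h sc by (simp add: E.m_assoc)
  also have "\<dots> = \<iota> (b g) \<otimes>\<^bsub>E\<^esub> \<iota> (b h) \<otimes>\<^bsub>E\<^esub> (s g \<otimes>\<^bsub>E\<^esub> s h)"
    using bgh g h sc central[of "b h" "s g", symmetric] by (simp add: E.m_assoc)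
  also have "\<dots> = \<iota> (b g) \<otimes>\<^bsub>E\<^esub> \<iota> (b h) \<otimes>\<^bsub>E\<^esub> \<iota> ?w \<otimes>\<^bsub>E\<^esub> s (g \<otimes>\<^bsub>G\<^esub> h)"
    using w bgh g h sc by (simp add: E.m_assoc)
  also have "\<dots> = \<iota> (?c \<otimes>\<^bsub>Z\<^esub> ?w) \<otimes>\<^bsub>E\<^esub> (\<iota> (b (g \<otimes>\<^bsub>G\<^esub> h)) \<otimes>\<^bsub>E\<^esub> s (g \<otimes>\<^bsub>G\<^esub> h))"
    unfolding e[symmetric] using bgh g h sc \<open>?c \<otimes>\<^bsub>Z\<^esub> ?w \<in> carrier Z\<close> by (simp add: E.m_assoc)
  finally show "\<iota> (b g) \<otimes>\<^bsub>E\<^esub> s g \<otimes>\<^bsub>E\<^esub> (\<iota> (b h) \<otimes>\<^bsub>E\<^esub> s h) =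
    \<iota> (?c \<otimes>\<^bsub>Z\<^esub> ?w) \<otimes>\<^bsub>E\<^esub> (\<iota> (b (g \<otimes>\<^bsub>G\<^esub> h)) \<otimes>\<^bsub>E\<^esub> s (g \<otimes>\<^bsub>G\<^esub> h))" .
qed

text \<open>The defect of \<open>s\<close> at a pair is \<open>\<iota>\<close> of the inverse of the
  cocycle value, and both inversion and \<open>\<iota>\<close> are injective.\<close>

lemma quasi_hom_section_iff:
  assumes s: "is_section E G \<pi> s"
  shows "quasi_hom G E s \<longleftrightarrow> finite (euler_cocycle Z E G \<iota> s ` (carrier G \<times> carrier G))"
proof -
  let ?w = "euler_cocycle Z E G \<iota> s"
  have defect: "inv\<^bsub>E\<^esub> (s h) \<otimes>\<^bsub>E\<^esub> inv\<^bsub>E\<^esub> (s g) \<otimes>\<^bsub>E\<^esub> s (g \<otimes>\<^bsub>G\<^esub> h) = \<iota> (inv\<^bsub>Z\<^esub> (?w (g, h)))"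
    if gh: "g \<in> carrier G" "h \<in> carrier G" for g h
  proof -
    note w = euler_cocycle_closed[OF s gh]
    have c: "s g \<in> carrier E" "s h \<in> carrier E" "s (g \<otimes>\<^bsub>G\<^esub> h) \<in> carrier E"
      using sectionD(1)[OF s] gh by auto
    have "s g \<otimes>\<^bsub>E\<^esub> s h \<otimes>\<^bsub>E\<^esub> \<iota> (inv\<^bsub>Z\<^esub> (?w (g, h)))
        = \<iota> (inv\<^bsub>Z\<^esub> (?w (g, h))) \<otimes>\<^bsub>E\<^esub> (\<iota> (?w (g, h)) \<otimes>\<^bsub>E\<^esub> s (g \<otimes>\<^bsub>G\<^esub> h))"
      using w c central[of "inv\<^bsub>Z\<^esub> (?w (g, h))" "s g \<otimes>\<^bsub>E\<^esub> s h"] by simp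
    also have "\<dots> = s (g \<otimes>\<^bsub>G\<^esub> h)"
      using w(1) c by (simp flip: E.m_assoc)
    finally have "s (g \<otimes>\<^bsub>G\<^esub> h) = s g \<otimes>\<^bsub>E\<^esub> s h \<otimes>\<^bsub>E\<^esub> \<iota> (inv\<^bsub>Z\<^esub> (?w (g, h)))" by simp
    then show ?thesis
      using w c E.inv_solve_left[of "\<iota> (inv\<^bsub>Z\<^esub> (?w (g, h)))" "s g \<otimes>\<^bsub>E\<^esub> s h" "s (g \<otimes>\<^bsub>G\<^esub> h)"]
      by (simp add: E.inv_mult_group)
  qed
  have "{inv\<^bsub>E\<^esub> (s h) \<otimes>\<^bsub>E\<^esub> inv\<^bsub>E\<^esub> (s g) \<otimes>\<^bsub>E\<^esub> s (g \<otimes>\<^bsub>G\<^esub> h) | g h. g \<in> carrier G \<and> h \<in> carrier G}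
      = (\<lambda>z. \<iota> (inv\<^bsub>Z\<^esub> z)) ` ?w ` (carrier G \<times> carrier G)"
    using defect by (force simp: image_iff)
  moreover have "inj_on (\<lambda>z. \<iota> (inv\<^bsub>Z\<^esub> z)) (?w ` (carrier G \<times> carrier G))"
    using euler_cocycle_closed(1)[OF s] by (auto intro!: inj_onI simp: iota_eq_iff)
  moreover have "s \<in> carrier G \<rightarrow> carrier E" using s by (simp add: is_section_def)
  ultimately show ?thesis by (simp add: quasi_hom_def finite_image_iff)
qed

text \<open>The normalisation s(1) = 1 costs nothing: s(1) lies in the image of \<open>Z\<close>,
  and dividing the section by this constant multiplies the cocycle by one fixed element.\<close>

lemma quasi_splits_iff:
  "quasi_splits E G \<pi> \<longleftrightarrow>
    (\<exists>s. is_section E G \<pi> s \<and> finite (euler_cocycle Z E G \<iota> s ` (carrier G \<times> carrier G)))"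
proof
  show "quasi_splits E G \<pi> \<Longrightarrow>
      \<exists>s. is_section E G \<pi> s \<and> finite (euler_cocycle Z E G \<iota> s ` (carrier G \<times> carrier G))"
    by (auto simp: quasi_splits_def quasi_hom_section_iff)
next
  assume "\<exists>s. is_section E G \<pi> s \<and> finite (euler_cocycle Z E G \<iota> s ` (carrier G \<times> carrier G))"
  then obtain s where s: "is_section E G \<pi> s"
    and fin: "finite (euler_cocycle Z E G \<iota> s ` (carrier G \<times> carrier G))" by blast
  interpret Z: comm_group Z by (rule Z_comm)
  obtain k where k: "k \<in> carrier Z" "s \<one>\<^bsub>G\<^esub> = \<iota> k"
    using kernel_cases[of "s \<one>\<^bsub>G\<^esub>"] sectionD[OF s, of "\<one>\<^bsub>G\<^esub>"] by auto
  define t where "t g = \<iota> (inv\<^bsub>Z\<^esub> k) \<otimes>\<^bsub>E\<^esub> s g" for g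
  have b: "(\<lambda>g. inv\<^bsub>Z\<^esub> k) \<in> carrier G \<rightarrow> carrier Z" using k by simp
  have t: "is_section E G \<pi> t"
    using section_shift[OF s b] by (simp add: t_def[abs_def])
  have "euler_cocycle Z E G \<iota> t p = inv\<^bsub>Z\<^esub> k \<otimes>\<^bsub>Z\<^esub> euler_cocycle Z E G \<iota> s p"
    if "p \<in> carrier G \<times> carrier G" for p
    using that euler_cocycle_shift[OF s b, of "fst p" "snd p"] k
    by (auto simp: t_def[abs_def] coboundary1_def Z.m_assoc)
  then have "euler_cocycle Z E G \<iota> t ` (carrier G \<times> carrier G) =
      (\<lambda>z. inv\<^bsub>Z\<^esub> k \<otimes>\<^bsub>Z\<^esub> z) ` euler_cocycle Z E G \<iota> s ` (carrier G \<times> carrier G)"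
    by (simp add: image_image)
  then have "quasi_hom G E t" using fin quasi_hom_section_iff[OF t] by simp
  moreover have "t \<one>\<^bsub>G\<^esub> = \<one>\<^bsub>E\<^esub>" using k by (simp add: t_def)
  ultimately show "quasi_splits E G \<pi>" using t by (auto simp: quasi_splits_def)
qed

lemma bounded_class_iff_quasi_splits:
  "bounded_class G (euler_class Z E G \<iota> \<pi>) \<longleftrightarrow> quasi_splits E G \<pi>"
proof
  assume "bounded_class G (euler_class Z E G \<iota> \<pi>)"
  moreover obtain s where s: "is_section E G \<pi> s" using section_exists by blast
  ultimately obtain b where b: "b \<in> carrier G \<rightarrow> carrier Z"
    and fin: "finite ((coboundary1 G Z b \<otimes>\<^bsub>cochains2 G Z\<^esub> euler_cocycle Z E G \<iota> s) `
      (carrier G \<times> carrier G))"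
    by (auto simp: bounded_class_def euler_class_eq[OF s] cohomology_class_def r_coset_def
        coboundaries2_def)
  let ?t = "\<lambda>g. \<iota> (b g) \<otimes>\<^bsub>E\<^esub> s g"
  have "euler_cocycle Z E G \<iota> ?t ` (carrier G \<times> carrier G) =
      (coboundary1 G Z b \<otimes>\<^bsub>cochains2 G Z\<^esub> euler_cocycle Z E G \<iota> s) ` (carrier G \<times> carrier G)"
    using euler_cocycle_shift[OF s b] by (intro image_cong) (auto simp: cochains2_def)
  then show "quasi_splits E G \<pi>"
    using fin section_shift[OF s b] unfolding quasi_splits_iff by metis
next
  assume "quasi_splits E G \<pi>"
  then obtain s where s: "is_section E G \<pi> s"
    and fin: "finite (euler_cocycle Z E G \<iota> s ` (carrier G \<times> carrier G))"
    by (auto simp: quasi_splits_iff)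
  interpret C: group "cochains2 G Z" by (rule group_cochains2)
  have "euler_cocycle Z E G \<iota> s \<in> euler_class Z E G \<iota> \<pi>"
    using C.rcos_self[OF _ subgroup_coboundaries2] euler_cocycle_in_cocycles2[OF s]
    by (auto simp: euler_class_eq[OF s] cohomology_class_def cocycles2_def)
  then show "bounded_class G (euler_class Z E G \<iota> \<pi>)"
    using fin by (auto simp: bounded_class_def)
qed

text \<open>The decomposition of \<open>e\<close> into a central factor and
  \<open>s (\<pi> e)\<close> is unique, so multiplying two decompositions identifies the defect of
  \<open>\<phi>\<close> with the cocycle. The normalisation at one makes \<open>\<phi>\<close> exact
  on \<open>Z\<close>. No coordinates of \<open>Z\<close> enter, so this also applies to the
  restricted extension in the transfer.\<close>

lemma quasi_splits_imp_quasi_retraction: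
  assumes "quasi_splits E G \<pi>"
  shows "\<exists>\<phi>. quasi_retraction Z E \<iota> \<phi>"
proof -
  interpret Z: comm_group Z by (rule Z_comm)
  obtain s where s: "is_section E G \<pi> s" and s1: "s \<one>\<^bsub>G\<^esub> = \<one>\<^bsub>E\<^esub>" and qh: "quasi_hom G E s"
    using assms by (auto simp: quasi_splits_def)
  let ?w = "euler_cocycle Z E G \<iota> s"
  define \<phi> where "\<phi> e = inv_into (carrier Z) \<iota> (e \<otimes>\<^bsub>E\<^esub> inv\<^bsub>E\<^esub> (s (\<pi> e)))" for e
  have \<phi>: "\<phi> e \<in> carrier Z" "\<iota> (\<phi> e) \<otimes>\<^bsub>E\<^esub> s (\<pi> e) = e" if "e \<in> carrier E" for e
    using kernel_lift[of "e \<otimes>\<^bsub>E\<^esub> inv\<^bsub>E\<^esub> (s (\<pi> e))"] sectionD[OF s, of "\<pi> e"] that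
    by (simp_all add: \<phi>_def E.m_assoc)
  have \<phi>_eqI: "\<phi> e = z" if "e \<in> carrier E" "z \<in> carrier Z" "\<iota> z \<otimes>\<^bsub>E\<^esub> s (\<pi> e) = e" for e z
  proof -
    have "\<iota> (\<phi> e) = \<iota> z"
      using that \<phi>[OF that(1)] sectionD(1)[OF s, of "\<pi> e"]
        E.right_cancel[of "s (\<pi> e)" "\<iota> (\<phi> e)" "\<iota> z"] by (simp del: E.right_cancel)
    then show ?thesis using that \<phi>[OF that(1)] iota_eq_iff by blast
  qed
  have mult: "\<phi> (e \<otimes>\<^bsub>E\<^esub> f) = \<phi> e \<otimes>\<^bsub>Z\<^esub> \<phi> f \<otimes>\<^bsub>Z\<^esub> ?w (\<pi> e, \<pi> f)"
    if e: "e \<in> carrier E" and f: "f \<in> carrier E" for e f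
  proof (rule \<phi>_eqI)
    have w: "?w (\<pi> e, \<pi> f) \<in> carrier Z"
      "\<iota> (?w (\<pi> e, \<pi> f)) \<otimes>\<^bsub>E\<^esub> s (\<pi> e \<otimes>\<^bsub>G\<^esub> \<pi> f) = s (\<pi> e) \<otimes>\<^bsub>E\<^esub> s (\<pi> f)"
      using euler_cocycle_closed[OF s, of "\<pi> e" "\<pi> f"] e f by auto
    have sc: "s (\<pi> e) \<in> carrier E" "s (\<pi> f) \<in> carrier E" "s (\<pi> e \<otimes>\<^bsub>G\<^esub> \<pi> f) \<in> carrier E"
      using sectionD[OF s] e f by auto
    show "\<phi> e \<otimes>\<^bsub>Z\<^esub> \<phi> f \<otimes>\<^bsub>Z\<^esub> ?w (\<pi> e, \<pi> f) \<in> carrier Z" using w \<phi> e f by simp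
    have "\<iota> (\<phi> e \<otimes>\<^bsub>Z\<^esub> \<phi> f \<otimes>\<^bsub>Z\<^esub> ?w (\<pi> e, \<pi> f)) \<otimes>\<^bsub>E\<^esub> s (\<pi> (e \<otimes>\<^bsub>E\<^esub> f)) =
        \<iota> (\<phi> e) \<otimes>\<^bsub>E\<^esub> (\<iota> (\<phi> f) \<otimes>\<^bsub>E\<^esub> s (\<pi> e)) \<otimes>\<^bsub>E\<^esub> s (\<pi> f)"
      using \<phi>(1) e f w sc by (simp add: E.m_assoc)
    also have "\<dots> = (\<iota> (\<phi> e) \<otimes>\<^bsub>E\<^esub> s (\<pi> e)) \<otimes>\<^bsub>E\<^esub> (\<iota> (\<phi> f) \<otimes>\<^bsub>E\<^esub> s (\<pi> f))"
      using \<phi>(1) e f sc central[of "\<phi> f" "s (\<pi> e)"] by (simp add: E.m_assoc)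
    finally show "\<iota> (\<phi> e \<otimes>\<^bsub>Z\<^esub> \<phi> f \<otimes>\<^bsub>Z\<^esub> ?w (\<pi> e, \<pi> f)) \<otimes>\<^bsub>E\<^esub> s (\<pi> (e \<otimes>\<^bsub>E\<^esub> f)) = e \<otimes>\<^bsub>E\<^esub> f"
      using \<phi>(2) e f by simp
  qed (use e f in simp)
  have "inv\<^bsub>Z\<^esub> (\<phi> f) \<otimes>\<^bsub>Z\<^esub> inv\<^bsub>Z\<^esub> (\<phi> e) \<otimes>\<^bsub>Z\<^esub> \<phi> (e \<otimes>\<^bsub>E\<^esub> f) = ?w (\<pi> e, \<pi> f)"
    if "e \<in> carrier E" "f \<in> carrier E" for e f
    using that \<phi>(1) euler_cocycle_closed(1)[OF s, of "\<pi> e" "\<pi> f"]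
    by (simp add: mult[OF that] Z.m_assoc Z.inv_solve_left' flip: Z.inv_mult_group)
  then have "{inv\<^bsub>Z\<^esub> (\<phi> f) \<otimes>\<^bsub>Z\<^esub> inv\<^bsub>Z\<^esub> (\<phi> e) \<otimes>\<^bsub>Z\<^esub> \<phi> (e \<otimes>\<^bsub>E\<^esub> f) | e f. e \<in> carrier E \<and> f \<in> carrier E}
      \<subseteq> ?w ` (carrier G \<times> carrier G)"
    by force
  then have "quasi_hom E Z \<phi>"
    using \<phi>(1) qh quasi_hom_section_iff[OF s] finite_subset by (auto simp: quasi_hom_def)
  moreover have "\<phi> (\<iota> z) = z" if "z \<in> carrier Z" for z
    using that s1 by (intro \<phi>_eqI) auto
  ultimately show ?thesis by (auto simp: quasi_retraction_def)
qed

lemma quasi_splits_imp_virtually: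
  assumes "quasi_splits E G \<pi>"
  shows "virtually_quasi_splits E G \<pi>"
proof -
  have "finite (rcosets\<^bsub>E\<^esub> (carrier E))"
  proof -
    have "rcosets\<^bsub>E\<^esub> (carrier E) \<subseteq> {carrier E}"
      using E.coset_join2[OF _ E.subgroup_self]
      by (auto simp: RCOSETS_def)
    then show ?thesis using finite_subset by blast
  qed
  then show ?thesis
    using assms E.subgroup_self pi_surj
    by (auto simp: virtually_quasi_splits_def intro!: exI[of _ "carrier E"])
qed

end


section \<open>Quasimorphisms and the transfer\<close>

definition quasimorphism :: "('a, 'm) monoid_scheme \<Rightarrow> real \<Rightarrow> ('a \<Rightarrow> real) \<Rightarrow> bool" where
  "quasimorphism A D \<beta> \<longleftrightarrow>
    (\<forall>g\<in>carrier A. \<forall>h\<in>carrier A. \<bar>\<beta> (g \<otimes>\<^bsub>A\<^esub> h) - \<beta> g - \<beta> h\<bar> \<le> D)"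

lemma quasimorphismD:
  "\<lbrakk>quasimorphism A D \<beta>; g \<in> carrier A; h \<in> carrier A\<rbrakk> \<Longrightarrow> \<bar>\<beta> (g \<otimes>\<^bsub>A\<^esub> h) - \<beta> g - \<beta> h\<bar> \<le> D"
  by (simp add: quasimorphism_def)

text \<open>Needed for the transfer, where a quasi-retraction takes values in a subgroup of
  \<open>Z\<close> but is measured with the coordinates of \<open>Z\<close>.\<close>

lemma (in group) quasi_hom_subgroup:
  assumes H: "subgroup H G" and qh: "quasi_hom A (G\<lparr>carrier := H\<rparr>) \<phi>"
  shows "quasi_hom A G \<phi>"
proof -
  have \<phi>: "\<phi> x \<in> H" if "x \<in> carrier A" for x using qh that by (auto simp: quasi_hom_def)
  have "{inv (\<phi> h) \<otimes> inv (\<phi> g) \<otimes> \<phi> (g \<otimes>\<^bsub>A\<^esub> h) | g h. g \<in> carrier A \<and> h \<in> carrier A}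
    = {inv\<^bsub>G\<lparr>carrier := H\<rparr>\<^esub> (\<phi> h) \<otimes>\<^bsub>G\<lparr>carrier := H\<rparr>\<^esub> inv\<^bsub>G\<lparr>carrier := H\<rparr>\<^esub> (\<phi> g) \<otimes>\<^bsub>G\<lparr>carrier := H\<rparr>\<^esub> \<phi> (g \<otimes>\<^bsub>A\<^esub> h)
        | g h. g \<in> carrier A \<and> h \<in> carrier A}"
    by (intro Collect_cong iff_exI) (auto simp: m_inv_consistent[OF H] \<phi>)
  then show ?thesis
    using qh \<phi> subgroup.mem_carrier[OF H] unfolding quasi_hom_def by auto
qed

text \<open>The structure of \<open>Z\<close> enters through r additive coordinates that are jointly
  onto the integer lattice and have finite preimages of bounded sets. The torsion group is absorbed
  in \<open>coord_finite\<close>; for r = 0 this axiom says that \<open>Z\<close> is finite.\<close>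

locale coordinatized_extension = central_extension Z E G \<iota> \<pi>
  for Z :: "('z, 'm) monoid_scheme" and E :: "('e, 'n) monoid_scheme"
    and G :: "('g, 'k) monoid_scheme" and \<iota> \<pi> +
  fixes r :: nat and \<kappa> :: "nat \<Rightarrow> 'z \<Rightarrow> int"
  assumes coord_mult: "\<lbrakk>k < r; x \<in> carrier Z; y \<in> carrier Z\<rbrakk> \<Longrightarrow> \<kappa> k (x \<otimes>\<^bsub>Z\<^esub> y) = \<kappa> k x + \<kappa> k y"
    and coord_finite: "finite {z \<in> carrier Z. \<forall>k<r. \<bar>\<kappa> k z\<bar> \<le> B}"
    and coord_surj: "\<exists>z\<in>carrier Z. \<forall>k<r. \<kappa> k z = c k"
begin

lemma coord_one [simp]: "k < r \<Longrightarrow> \<kappa> k \<one>\<^bsub>Z\<^esub> = 0"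
  using coord_mult[of k "\<one>\<^bsub>Z\<^esub>" "\<one>\<^bsub>Z\<^esub>"] by simp

lemma coord_inv: "\<lbrakk>k < r; x \<in> carrier Z\<rbrakk> \<Longrightarrow> \<kappa> k (inv\<^bsub>Z\<^esub> x) = - \<kappa> k x"
  using coord_mult[of k x "inv\<^bsub>Z\<^esub> x"] by simp

text \<open>With the converse below, this translates between finite defect sets in \<open>Z\<close>
  and bounded defects of real functions.\<close>

lemma finite_if_coord_bounded:
  assumes "\<And>z. z \<in> A \<Longrightarrow> z \<in> carrier Z" "\<And>z k. z \<in> A \<Longrightarrow> k < r \<Longrightarrow> \<bar>real_of_int (\<kappa> k z)\<bar> \<le> B"
  shows "finite A"
proof (rule finite_subset)
  show "A \<subseteq> {z \<in> carrier Z. \<forall>k<r. \<bar>\<kappa> k z\<bar> \<le> \<lfloor>B\<rfloor>}"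
    using assms by (auto simp: le_floor_iff)
qed (rule coord_finite)

lemma coord_bounded_if_finite:
  assumes "finite A"
  obtains B :: real where "B \<ge> 0" "\<And>z k. z \<in> A \<Longrightarrow> k < r \<Longrightarrow> \<bar>real_of_int (\<kappa> k z)\<bar> \<le> B"
proof
  \<comment> \<open>A sum instead of a maximum, so that empty \<open>A\<close> and r = 0 need no
    separate treatment.\<close>
  let ?B = "\<Sum>z\<in>A. \<Sum>k<r. \<bar>real_of_int (\<kappa> k z)\<bar>"
  show "?B \<ge> 0" by (simp add: sum_nonneg)
  fix z k assume "z \<in> A" "k < r"
  then have "\<bar>real_of_int (\<kappa> k z)\<bar> \<le> (\<Sum>k<r. \<bar>real_of_int (\<kappa> k z)\<bar>)"
    by (intro member_le_sum) auto
  also have "\<dots> \<le> ?B"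
    using \<open>z \<in> A\<close> assms
    by (intro member_le_sum[of z A "\<lambda>z. \<Sum>k<r. \<bar>real_of_int (\<kappa> k z)\<bar>"]) (auto simp: sum_nonneg)
  finally show "\<bar>real_of_int (\<kappa> k z)\<bar> \<le> ?B" .
qed

lemma quasi_hom_coord:
  assumes A: "group A" and qh: "quasi_hom A Z \<phi>"
  obtains D where "D \<ge> 0" "\<And>k. k < r \<Longrightarrow> quasimorphism A D (\<lambda>x. real_of_int (\<kappa> k (\<phi> x)))"
proof -
  interpret A: group A by (rule A)
  let ?S = "{inv\<^bsub>Z\<^esub> (\<phi> h) \<otimes>\<^bsub>Z\<^esub> inv\<^bsub>Z\<^esub> (\<phi> g) \<otimes>\<^bsub>Z\<^esub> \<phi> (g \<otimes>\<^bsub>A\<^esub> h) | g h.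
    g \<in> carrier A \<and> h \<in> carrier A}"
  have \<phi>: "\<phi> x \<in> carrier Z" if "x \<in> carrier A" for x using qh that by (auto simp: quasi_hom_def)
  have "finite ?S" using qh by (simp add: quasi_hom_def)
  then obtain D where D: "D \<ge> 0" "\<And>z k. z \<in> ?S \<Longrightarrow> k < r \<Longrightarrow> \<bar>real_of_int (\<kappa> k z)\<bar> \<le> D"
    using coord_bounded_if_finite by blast
  have "quasimorphism A D (\<lambda>x. real_of_int (\<kappa> k (\<phi> x)))" if k: "k < r" for k
    unfolding quasimorphism_def
  proof (intro ballI)
    fix g h assume gh: "g \<in> carrier A" "h \<in> carrier A"
    then have "\<bar>real_of_int (\<kappa> k (inv\<^bsub>Z\<^esub> (\<phi> h) \<otimes>\<^bsub>Z\<^esub> inv\<^bsub>Z\<^esub> (\<phi> g) \<otimes>\<^bsub>Z\<^esub> \<phi> (g \<otimes>\<^bsub>A\<^esub> h)))\<bar> \<le> D"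
      using k by (intro D(2)) auto
    then show "\<bar>real_of_int (\<kappa> k (\<phi> (g \<otimes>\<^bsub>A\<^esub> h))) - real_of_int (\<kappa> k (\<phi> g))
        - real_of_int (\<kappa> k (\<phi> h))\<bar> \<le> D"
      using k gh \<phi> by (simp add: coord_mult coord_inv)
  qed
  then show thesis using D(1) that by blast
qed

text \<open>Taking floors of the \<open>T k\<close> and lifting them by \<open>coord_surj\<close>
  moves every coordinate by less than 1, and overwriting the result on the image of \<open>Z\<close>
  costs at most \<open>C\<close> there. The defect therefore grows by three such errors.\<close>

lemma quasi_retraction_if_coarse:
  assumes D: "\<And>k. k < r \<Longrightarrow> quasimorphism E D (T k)"
    and C: "\<And>k z. \<lbrakk>k < r; z \<in> carrier Z\<rbrakk> \<Longrightarrow> \<bar>T k (\<iota> z) - real_of_int (\<kappa> k z)\<bar> \<le> C"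
  shows "\<exists>\<phi>. quasi_retraction Z E \<iota> \<phi>"
proof -
  define \<psi> where "\<psi> e = (SOME z. z \<in> carrier Z \<and> (\<forall>k<r. \<kappa> k z = \<lfloor>T k e\<rfloor>))" for e
  have \<psi>: "\<psi> e \<in> carrier Z \<and> (\<forall>k<r. \<kappa> k (\<psi> e) = \<lfloor>T k e\<rfloor>)" for e
    unfolding \<psi>_def by (rule someI_ex) (use coord_surj[of "\<lambda>k. \<lfloor>T k e\<rfloor>"] in blast)
  \<comment> \<open>The lift \<open>\<psi>\<close> is determined only up to elements with zero
    coordinates, so on the image of \<open>Z\<close> the exact preimage is imposed.\<close>
  define \<phi> where "\<phi> e = (if e \<in> \<iota> ` carrier Z then inv_into (carrier Z) \<iota> e else \<psi> e)" for e
  have \<phi>c: "\<phi> e \<in> carrier Z" for e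
    using \<psi>[of e] inv_into_into[of e \<iota> "carrier Z"] by (simp add: \<phi>_def)
  have \<phi>\<iota>: "\<phi> (\<iota> z) = z" if "z \<in> carrier Z" for z
    using that iota_inj by (simp add: \<phi>_def)
  define B where "B = max C 1"
  have near: "\<bar>real_of_int (\<kappa> k (\<phi> e)) - T k e\<bar> \<le> B" if k: "k < r" for k e
  proof (cases "e \<in> \<iota> ` carrier Z")
    case True
    then obtain z where z: "z \<in> carrier Z" "e = \<iota> z" by blast
    show ?thesis using C[OF k z(1)] \<phi>\<iota>[OF z(1)] z(2) by (auto simp: B_def)
  next
    case False
    then have "\<kappa> k (\<phi> e) = \<lfloor>T k e\<rfloor>" using \<psi> k by (simp add: \<phi>_def)
    then show ?thesis unfolding B_def by linarith
  qed
  have "quasi_hom E Z \<phi>"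
    unfolding quasi_hom_def
  proof
    show "\<phi> \<in> carrier E \<rightarrow> carrier Z" using \<phi>c by blast
    show "finite {inv\<^bsub>Z\<^esub> (\<phi> h) \<otimes>\<^bsub>Z\<^esub> inv\<^bsub>Z\<^esub> (\<phi> g) \<otimes>\<^bsub>Z\<^esub> \<phi> (g \<otimes>\<^bsub>E\<^esub> h) | g h.
        g \<in> carrier E \<and> h \<in> carrier E}"
    proof (rule finite_if_coord_bounded)
      fix z k
      assume "z \<in> {inv\<^bsub>Z\<^esub> (\<phi> h) \<otimes>\<^bsub>Z\<^esub> inv\<^bsub>Z\<^esub> (\<phi> g) \<otimes>\<^bsub>Z\<^esub> \<phi> (g \<otimes>\<^bsub>E\<^esub> h) | g h.
        g \<in> carrier E \<and> h \<in> carrier E}" and k: "k < r"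
      then obtain g h where g: "g \<in> carrier E" and h: "h \<in> carrier E"
        and z: "z = inv\<^bsub>Z\<^esub> (\<phi> h) \<otimes>\<^bsub>Z\<^esub> inv\<^bsub>Z\<^esub> (\<phi> g) \<otimes>\<^bsub>Z\<^esub> \<phi> (g \<otimes>\<^bsub>E\<^esub> h)" by blast
      have "real_of_int (\<kappa> k z) = real_of_int (\<kappa> k (\<phi> (g \<otimes>\<^bsub>E\<^esub> h)))
          - real_of_int (\<kappa> k (\<phi> g)) - real_of_int (\<kappa> k (\<phi> h))"
        using k \<phi>c by (simp add: z coord_mult coord_inv)
      then show "\<bar>real_of_int (\<kappa> k z)\<bar> \<le> D + 3 * B"
        using near[OF k, of g] near[OF k, of h] near[OF k, of "g \<otimes>\<^bsub>E\<^esub> h"]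
          quasimorphismD[OF D[OF k] g h] by linarith
    qed (use \<phi>c in auto)
  qed
  then show ?thesis using \<phi>\<iota> by (auto simp: quasi_retraction_def)
qed

text \<open>Dividing an arbitrary section by its \<open>\<phi>\<close>-value makes
  \<open>\<phi>\<close> bounded along the new section. Evaluating \<open>\<phi>\<close> on both
  sides of the cocycle equation then bounds the cocycle.\<close>

lemma quasi_retraction_imp_quasi_splits:
  assumes "quasi_retraction Z E \<iota> \<phi>"
  shows "quasi_splits E G \<pi>"
proof -
  have qh: "quasi_hom E Z \<phi>" and \<phi>\<iota>: "\<And>z. z \<in> carrier Z \<Longrightarrow> \<phi> (\<iota> z) = z"
    using assms by (auto simp: quasi_retraction_def)
  have \<phi>c: "\<phi> x \<in> carrier Z" if "x \<in> carrier E" for x using qh that by (auto simp: quasi_hom_def)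
  obtain D where D: "D \<ge> 0" "\<And>k. k < r \<Longrightarrow> quasimorphism E D (\<lambda>x. real_of_int (\<kappa> k (\<phi> x)))"
    using quasi_hom_coord[OF E.is_group qh] by blast
  obtain s0 where s0: "is_section E G \<pi> s0" using section_exists by blast
  define b where "b g = inv\<^bsub>Z\<^esub> (\<phi> (s0 g))" for g
  have b: "b \<in> carrier G \<rightarrow> carrier Z" using \<phi>c sectionD[OF s0] by (auto simp: b_def)
  define s where "s g = \<iota> (b g) \<otimes>\<^bsub>E\<^esub> s0 g" for g
  have s: "is_section E G \<pi> s" using section_shift[OF s0 b] by (simp add: s_def[abs_def])
  have small: "\<bar>real_of_int (\<kappa> k (\<phi> (s g)))\<bar> \<le> D" if k: "k < r" and g: "g \<in> carrier G" for k g
  proof -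
    have "\<phi> (\<iota> (b g)) = b g" using b g \<phi>\<iota> by auto
    then have "\<kappa> k (\<phi> (\<iota> (b g))) = - \<kappa> k (\<phi> (s0 g))"
      using k g \<phi>c sectionD[OF s0] by (simp add: b_def coord_inv)
    moreover have "\<iota> (b g) \<in> carrier E" using b g by (simp add: Pi_iff)
    ultimately show ?thesis
      using quasimorphismD[OF D(2)[OF k], of "\<iota> (b g)" "s0 g"] sectionD(1)[OF s0 g]
      by (simp add: s_def)
  qed
  have "finite (euler_cocycle Z E G \<iota> s ` (carrier G \<times> carrier G))"
  proof (rule finite_if_coord_bounded)
    fix z k assume "z \<in> euler_cocycle Z E G \<iota> s ` (carrier G \<times> carrier G)" and k: "k < r"
    then obtain g h where g: "g \<in> carrier G" and h: "h \<in> carrier G"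
      and z: "z = euler_cocycle Z E G \<iota> s (g, h)" by auto
    have w: "z \<in> carrier Z" "\<iota> z \<otimes>\<^bsub>E\<^esub> s (g \<otimes>\<^bsub>G\<^esub> h) = s g \<otimes>\<^bsub>E\<^esub> s h"
      using euler_cocycle_closed[OF s g h] z by simp_all
    have c: "s g \<in> carrier E" "s h \<in> carrier E" "s (g \<otimes>\<^bsub>G\<^esub> h) \<in> carrier E"
      using sectionD(1)[OF s] g h by auto
    have "\<bar>real_of_int (\<kappa> k (\<phi> (\<iota> z \<otimes>\<^bsub>E\<^esub> s (g \<otimes>\<^bsub>G\<^esub> h)))) - real_of_int (\<kappa> k z)
        - real_of_int (\<kappa> k (\<phi> (s (g \<otimes>\<^bsub>G\<^esub> h))))\<bar> \<le> D"
      using quasimorphismD[OF D(2)[OF k], of "\<iota> z" "s (g \<otimes>\<^bsub>G\<^esub> h)"] w(1) c \<phi>\<iota> by simp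
    \<comment> \<open>Two defects of \<open>\<phi>\<close>, one for each side of the cocycle
      equation, and its three values along the section, each at most \<open>D\<close>.\<close>
    then show "\<bar>real_of_int (\<kappa> k z)\<bar> \<le> 5 * D"
      using quasimorphismD[OF D(2)[OF k] c(1,2)] small[OF k g] small[OF k h]
        small[OF k, of "g \<otimes>\<^bsub>G\<^esub> h"] g h unfolding w(2) by auto
  qed (use euler_cocycle_closed(1)[OF s] in auto)
  then show ?thesis using s quasi_splits_iff by blast
qed

section \<open>Transfer from a finite-index subgroup\<close>

text \<open>The transfer: average the quasi-retraction of \<open>E'\<close> over the \<open>E'\<close>-parts of the right
  multiplication of \<open>e\<close> on a set of coset representatives.\<close>

lemma virtually_quasi_splits_imp_quasi_retraction:
  assumes "virtually_quasi_splits E G \<pi>"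
  shows "\<exists>\<phi>. quasi_retraction Z E \<iota> \<phi>"
proof -
  obtain E' where E': "subgroup E' E" and fin: "finite (rcosets\<^bsub>E\<^esub> E')"
    and qs: "quasi_splits (E\<lparr>carrier := E'\<rparr>) (G\<lparr>carrier := \<pi> ` E'\<rparr>) \<pi>"
    using assms by (auto simp: virtually_quasi_splits_def)
  interpret E': subgroup E' E by (rule E')
  let ?Z' = "{z \<in> carrier Z. \<iota> z \<in> E'}"
  interpret R: central_extension "Z\<lparr>carrier := ?Z'\<rparr>" "E\<lparr>carrier := E'\<rparr>"
    "G\<lparr>carrier := \<pi> ` E'\<rparr>" \<iota> \<pi>
    by (rule central_extension_restrict[OF E'])
  obtain \<phi> where \<phi>: "quasi_retraction (Z\<lparr>carrier := ?Z'\<rparr>) (E\<lparr>carrier := E'\<rparr>) \<iota> \<phi>"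
    using R.quasi_splits_imp_quasi_retraction[OF qs] by blast
  have \<phi>\<iota>: "\<phi> (\<iota> z) = z" if "z \<in> carrier Z" "\<iota> z \<in> E'" for z
    using \<phi> that by (auto simp: quasi_retraction_def)
  have "subgroup ?Z' Z"
    by (rule Z.subgroupI) (auto intro!: exI[of _ "\<one>\<^bsub>Z\<^esub>"])
  then have "quasi_hom (E\<lparr>carrier := E'\<rparr>) Z \<phi>"
    using \<phi> Z.quasi_hom_subgroup by (auto simp: quasi_retraction_def)
  then obtain D where D: "D \<ge> 0"
      "\<And>k. k < r \<Longrightarrow> quasimorphism (E\<lparr>carrier := E'\<rparr>) D (\<lambda>x. real_of_int (\<kappa> k (\<phi> x)))"
    using quasi_hom_coord[OF R.E.is_group] by blast
  define Q where "Q = rcosets\<^bsub>E\<^esub> E'"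
  define n where "n = real (card Q)"
  have Q0: "E' #>\<^bsub>E\<^esub> \<one>\<^bsub>E\<^esub> \<in> Q" using E.rcosetsI[OF E'.subset] by (simp add: Q_def)
  have finQ: "finite Q" using fin by (simp add: Q_def)
  have n: "n > 0" using finQ Q0 by (auto simp: n_def card_gt_0_iff)
  define t where "t C = (SOME x. x \<in> C)" for C :: "'e set"
  have t: "t C \<in> carrier E" "C = E' #>\<^bsub>E\<^esub> t C" if C: "C \<in> Q" for C
  proof -
    obtain a where a: "a \<in> carrier E" "C = E' #>\<^bsub>E\<^esub> a"
      using C by (auto simp: Q_def RCOSETS_def)
    then have "t C \<in> C"
      unfolding t_def using E.rcos_self[OF a(1) E'] by (intro someI[of "\<lambda>x. x \<in> C" a]) simp
    then show "t C \<in> carrier E" "C = E' #>\<^bsub>E\<^esub> t C"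
      using a E.repr_independence[OF _ a(1) E'] E.r_coset_subset_G[OF E'.subset a(1)] by auto
  qed
  have shift: "C #>\<^bsub>E\<^esub> e \<in> Q" if "C \<in> Q" "e \<in> carrier E" for C e
    using that t[OF that(1)] E.coset_mult_assoc[OF E'.subset, of "t C" e]
      E.rcosetsI[OF E'.subset, of "t C \<otimes>\<^bsub>E\<^esub> e"] by (simp add: Q_def)
  have QE: "C \<subseteq> carrier E" if "C \<in> Q" for C
    using t[OF that] E.r_coset_subset_G[OF E'.subset] by blast
  \<comment> \<open>Right multiplication by \<open>e\<close> sends the representative of
    \<open>C\<close> into the coset \<open>C e\<close>; \<open>h C e\<close> is the factor in E'
    that corrects it to the representative of \<open>C e\<close>.\<close>
  define h where "h C e = t C \<otimes>\<^bsub>E\<^esub> e \<otimes>\<^bsub>E\<^esub> inv\<^bsub>E\<^esub> (t (C #>\<^bsub>E\<^esub> e))" for C e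
  have hE': "h C e \<in> E'" if C: "C \<in> Q" and e: "e \<in> carrier E" for C e
  proof -
    note tC = t[OF C] and tCe = t[OF shift[OF C e]]
    have "t C \<otimes>\<^bsub>E\<^esub> e \<in> E' #>\<^bsub>E\<^esub> (t C \<otimes>\<^bsub>E\<^esub> e)" using tC e E.rcos_self[OF _ E'] by simp
    also have "\<dots> = C #>\<^bsub>E\<^esub> e" using tC e E.coset_mult_assoc[OF E'.subset, of "t C" e] by simp
    finally have "t C \<otimes>\<^bsub>E\<^esub> e \<in> E' #>\<^bsub>E\<^esub> t (C #>\<^bsub>E\<^esub> e)" using tCe by simp
    then obtain x where x: "x \<in> E'" "t C \<otimes>\<^bsub>E\<^esub> e = x \<otimes>\<^bsub>E\<^esub> t (C #>\<^bsub>E\<^esub> e)"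
      by (auto simp: r_coset_def)
    then have "h C e = x" using tCe E'.subset by (auto simp: h_def E.m_assoc)
    then show ?thesis using x by simp
  qed
  have h_mult: "h C (e \<otimes>\<^bsub>E\<^esub> f) = h C e \<otimes>\<^bsub>E\<^esub> h (C #>\<^bsub>E\<^esub> e) f"
    if C: "C \<in> Q" and e: "e \<in> carrier E" and f: "f \<in> carrier E" for C e f
  proof -
    have "C #>\<^bsub>E\<^esub> e #>\<^bsub>E\<^esub> f = C #>\<^bsub>E\<^esub> (e \<otimes>\<^bsub>E\<^esub> f)" using E.coset_mult_assoc[OF QE[OF C] e f] .
    moreover have "inv\<^bsub>E\<^esub> x \<otimes>\<^bsub>E\<^esub> (x \<otimes>\<^bsub>E\<^esub> y) = y" if "x \<in> carrier E" "y \<in> carrier E" for x y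
      using that by (simp flip: E.m_assoc)
    ultimately show ?thesis
      using t(1)[OF C] t(1)[OF shift[OF C e]] t(1)[OF shift[OF C, of "e \<otimes>\<^bsub>E\<^esub> f"]] e f
      by (simp add: h_def E.m_assoc)
  qed
  \<comment> \<open>Dividing by the index makes the average agree with the coordinate
    \<open>\<kappa> k\<close> on the part of \<open>Z\<close> inside E', rather than with a multiple
    of it.\<close>
  define T where "T k e = (\<Sum>C\<in>Q. real_of_int (\<kappa> k (\<phi> (h C e)))) / n" for k e
  have T: "quasimorphism E D (T k)" if k: "k < r" for k
    unfolding quasimorphism_def
  proof (intro ballI)
    fix e f assume e: "e \<in> carrier E" and f: "f \<in> carrier E"
    let ?\<beta> = "\<lambda>x. real_of_int (\<kappa> k (\<phi> x))"
    \<comment> \<open>Right multiplication by \<open>e\<close> permutes the cosets. Hence the defect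
      of the average is an average of defects and stays below the same \<open>D\<close>.\<close>
    have "(\<Sum>C\<in>Q. ?\<beta> (h (C #>\<^bsub>E\<^esub> e) f)) = (\<Sum>C\<in>Q. ?\<beta> (h C f))"
      using e shift QE
      by (intro sum.reindex_bij_witness[of _ "\<lambda>C. C #>\<^bsub>E\<^esub> inv\<^bsub>E\<^esub> e" "\<lambda>C. C #>\<^bsub>E\<^esub> e"])
        (auto simp: E.coset_mult_assoc)
    then have "T k (e \<otimes>\<^bsub>E\<^esub> f) - T k e - T k f =
        (\<Sum>C\<in>Q. ?\<beta> (h C e \<otimes>\<^bsub>E\<^esub> h (C #>\<^bsub>E\<^esub> e) f) - ?\<beta> (h C e) - ?\<beta> (h (C #>\<^bsub>E\<^esub> e) f)) / n"
      using h_mult e f by (simp add: T_def sum_subtractf diff_divide_distrib)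
    also have "\<bar>\<dots>\<bar> \<le> (\<Sum>C\<in>Q. D) / n"
      unfolding abs_divide
    proof (rule frac_le)
      show "\<bar>\<Sum>C\<in>Q. ?\<beta> (h C e \<otimes>\<^bsub>E\<^esub> h (C #>\<^bsub>E\<^esub> e) f) - ?\<beta> (h C e) - ?\<beta> (h (C #>\<^bsub>E\<^esub> e) f)\<bar> \<le> (\<Sum>C\<in>Q. D)"
        using hE' shift e f quasimorphismD[OF D(2)[OF k]]
        by (intro order_trans[OF sum_abs] sum_mono) auto
    qed (use n D in \<open>auto intro: sum_nonneg\<close>)
    also have "\<dots> = D" using n by (simp add: n_def)
    finally show "\<bar>T k (e \<otimes>\<^bsub>E\<^esub> f) - T k e - T k f\<bar> \<le> D" .
  qed
  \<comment> \<open>A central element of E' fixes every coset and commutes with its representative,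
    so each summand is the same.\<close>
  have T_restrict: "T k (\<iota> z) = real_of_int (\<kappa> k z)" if "z \<in> carrier Z" "\<iota> z \<in> E'" for k z
  proof -
    have "h C (\<iota> z) = \<iota> z" if C: "C \<in> Q" for C
    proof -
      have "C #>\<^bsub>E\<^esub> \<iota> z = E' #>\<^bsub>E\<^esub> (\<iota> z \<otimes>\<^bsub>E\<^esub> t C)"
        using t[OF C] \<open>z \<in> carrier Z\<close> central[of z "t C"]
          E.coset_mult_assoc[OF E'.subset, of "t C" "\<iota> z"] by simp
      also have "\<dots> = C"
        using t[OF C] \<open>z \<in> carrier Z\<close> E.coset_mult_assoc[OF E'.subset, of "\<iota> z" "t C"]
          E.coset_join2[OF _ E' \<open>\<iota> z \<in> E'\<close>] by simp
      finally show ?thesis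
        using t[OF C] \<open>z \<in> carrier Z\<close> central[of z "t C", symmetric] by (simp add: h_def E.m_assoc)
    qed
    then show ?thesis using n that \<phi>\<iota> by (simp add: T_def n_def)
  qed
  \<comment> \<open>The image of \<open>Z\<close> need not lie in E', but it meets only finitely
    many cosets. With one representative \<open>c C\<close> in \<open>Z\<close> for each of them,
    the error at any \<open>z\<close> is at most \<open>D\<close> plus the error at a
    representative.\<close>
  define \<delta> where "\<delta> k z = \<bar>T k (\<iota> z) - real_of_int (\<kappa> k z)\<bar>" for k z
  define S where "S = (\<lambda>z. E' #>\<^bsub>E\<^esub> \<iota> z) ` carrier Z"
  define c where "c C = (SOME z. z \<in> carrier Z \<and> E' #>\<^bsub>E\<^esub> \<iota> z = C)" for C
  have c: "c C \<in> carrier Z \<and> E' #>\<^bsub>E\<^esub> \<iota> (c C) = C" if "C \<in> S" for C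
    unfolding c_def by (rule someI_ex) (use that in \<open>auto simp: S_def\<close>)
  have "S \<subseteq> Q" unfolding S_def Q_def using E.rcosetsI[OF E'.subset] by auto
  then have finS: "finite S" using finQ finite_subset by blast
  show ?thesis
  proof (rule quasi_retraction_if_coarse[OF T])
    fix k z assume k: "k < r" and z: "z \<in> carrier Z"
    let ?C = "E' #>\<^bsub>E\<^esub> \<iota> z"
    have C: "?C \<in> S" using z by (simp add: S_def)
    define y where "y = z \<otimes>\<^bsub>Z\<^esub> inv\<^bsub>Z\<^esub> (c ?C)"
    have y: "y \<in> carrier Z" "z = y \<otimes>\<^bsub>Z\<^esub> c ?C"
      using z c[OF C] by (auto simp: y_def Z.m_assoc)
    have "\<iota> z \<in> E' #>\<^bsub>E\<^esub> \<iota> (c ?C)" using c[OF C] z E.rcos_self[OF _ E', of "\<iota> z"] by simp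
    then have "\<iota> z \<otimes>\<^bsub>E\<^esub> inv\<^bsub>E\<^esub> \<iota> (c ?C) \<in> E'"
      using E'.rcos_module_imp[OF E.is_group] c[OF C] by auto
    then have "\<iota> y \<in> E'" using z c[OF C] by (simp add: y_def)
    then have "T k (\<iota> y) = \<kappa> k y" using T_restrict y by blast
    moreover have "\<bar>T k (\<iota> z) - T k (\<iota> y) - T k (\<iota> (c ?C))\<bar> \<le> D"
      using quasimorphismD[OF T[OF k], of "\<iota> y" "\<iota> (c ?C)"] y c[OF C] by (metis iota.hom_closed iota.hom_mult)
    moreover have "\<kappa> k z = \<kappa> k y + \<kappa> k (c ?C)" using coord_mult[OF k, of y "c ?C"] y c[OF C] by metis
    ultimately have "\<delta> k z \<le> D + \<delta> k (c ?C)" unfolding \<delta>_def by linarith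
    also have "\<delta> k (c ?C) \<le> (\<Sum>k<r. \<delta> k (c ?C))"
      using k by (intro member_le_sum[of k _ "\<lambda>k. \<delta> k (c ?C)"]) (auto simp: \<delta>_def)
    also have "\<dots> \<le> (\<Sum>C\<in>S. \<Sum>k<r. \<delta> k (c C))"
      using C finS by (intro member_le_sum[of ?C _ "\<lambda>C. \<Sum>k<r. \<delta> k (c C)"])
        (auto simp: \<delta>_def sum_nonneg)
    finally show "\<bar>T k (\<iota> z) - real_of_int (\<kappa> k z)\<bar> \<le> D + (\<Sum>C\<in>S. \<Sum>k<r. \<delta> k (c C))"
      by (simp add: \<delta>_def)
  qed
qed

end


section \<open>Isometric actions\<close>

text \<open>A \<open>group_action\<close> is a homomorphism into \<open>BijGroup\<close>, whose
  elements are extensional bijections; this is why extensionality is assumed here. Bijectivity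
  follows from the action of the inverse.\<close>

lemma isometric_actionI:
  assumes A: "group A"
    and closed: "\<And>g x. \<lbrakk>g \<in> carrier A; x \<in> mspace M\<rbrakk> \<Longrightarrow> \<phi> g x \<in> mspace M"
    and ext: "\<And>g. g \<in> carrier A \<Longrightarrow> \<phi> g \<in> extensional (mspace M)"
    and mult: "\<And>g h x. \<lbrakk>g \<in> carrier A; h \<in> carrier A; x \<in> mspace M\<rbrakk> \<Longrightarrow>
      \<phi> (g \<otimes>\<^bsub>A\<^esub> h) x = \<phi> g (\<phi> h x)"
    and one: "\<And>x. x \<in> mspace M \<Longrightarrow> \<phi> \<one>\<^bsub>A\<^esub> x = x"
    and isom: "\<And>g x y. \<lbrakk>g \<in> carrier A; x \<in> mspace M; y \<in> mspace M\<rbrakk> \<Longrightarrow>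
      mdist M (\<phi> g x) (\<phi> g y) = mdist M x y"
  shows "isometric_action A M \<phi>"
proof -
  interpret A: group A by (rule A)
  have cancel: "\<phi> g (\<phi> (inv\<^bsub>A\<^esub> g) x) = x" "\<phi> (inv\<^bsub>A\<^esub> g) (\<phi> g x) = x"
    if "g \<in> carrier A" "x \<in> mspace M" for g x
    using that mult[of g "inv\<^bsub>A\<^esub> g" x] mult[of "inv\<^bsub>A\<^esub> g" g x] one by simp_all
  have Bij: "\<phi> g \<in> Bij (mspace M)" if g: "g \<in> carrier A" for g
  proof -
    have "bij_betw (\<phi> g) (mspace M) (mspace M)"
      using g cancel closed by (intro bij_betwI[where g = "\<phi> (inv\<^bsub>A\<^esub> g)"]) auto
    then show ?thesis using ext[OF g] by (simp add: Bij_def)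
  qed
  have "\<phi> (g \<otimes>\<^bsub>A\<^esub> h) = compose (mspace M) (\<phi> g) (\<phi> h)" if "g \<in> carrier A" "h \<in> carrier A" for g h
    using that ext mult by (intro extensionalityI[of _ "mspace M"]) (auto simp: compose_eq)
  then have "\<phi> \<in> hom A (BijGroup (mspace M))"
    using Bij by (simp add: hom_def BijGroup_def)
  then have "group_hom A (BijGroup (mspace M)) \<phi>"
    by (simp add: group_hom_def group_hom_axioms_def A group_BijGroup)
  then show ?thesis
    using isom by (simp add: isometric_action_def group_action_def)
qed

lemma isometric_actionD:
  assumes "isometric_action A M \<phi>"
  shows "\<And>g x. \<lbrakk>g \<in> carrier A; x \<in> mspace M\<rbrakk> \<Longrightarrow> \<phi> g x \<in> mspace M"
    and "\<And>g. g \<in> carrier A \<Longrightarrow> \<phi> g \<in> extensional (mspace M)"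
    and "\<And>g h x. \<lbrakk>g \<in> carrier A; h \<in> carrier A; x \<in> mspace M\<rbrakk> \<Longrightarrow>
      \<phi> (g \<otimes>\<^bsub>A\<^esub> h) x = \<phi> g (\<phi> h x)"
    and "\<And>x. x \<in> mspace M \<Longrightarrow> \<phi> \<one>\<^bsub>A\<^esub> x = x"
    and "\<And>g x y. \<lbrakk>g \<in> carrier A; x \<in> mspace M; y \<in> mspace M\<rbrakk> \<Longrightarrow>
      mdist M (\<phi> g x) (\<phi> g y) = mdist M x y"
proof -
  interpret group_action A "mspace M" \<phi> using assms by (simp add: isometric_action_def)
  show "\<phi> g x \<in> mspace M" if "g \<in> carrier A" "x \<in> mspace M" for g x
    using element_image[OF that] by blast
  show "\<phi> g \<in> extensional (mspace M)" if "g \<in> carrier A" for g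
    using bij_prop0[OF that] by (simp add: Bij_def)
  show "\<phi> (g \<otimes>\<^bsub>A\<^esub> h) x = \<phi> g (\<phi> h x)"
    if "g \<in> carrier A" "h \<in> carrier A" "x \<in> mspace M" for g h x
    using composition_rule that by simp
  show "\<phi> \<one>\<^bsub>A\<^esub> x = x" if "x \<in> mspace M" for x
    using id_eq_one that by (metis restrict_apply')
  show "mdist M (\<phi> g x) (\<phi> g y) = mdist M x y"
    if "g \<in> carrier A" "x \<in> mspace M" "y \<in> mspace M" for g x y
    using assms that by (simp add: isometric_action_def)
qed

lemma isometric_action_hom:
  assumes "isometric_action A M \<phi>" "group_hom B A f"
  shows "isometric_action B M (\<lambda>b. \<phi> (f b))"
proof -
  interpret f: group_hom B A f by (rule assms)
  note \<phi> = isometric_actionD[OF assms(1)]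
  show ?thesis
    by (rule isometric_actionI) (use \<phi> f.G.is_group in auto)
qed

lemma isometric_action_diagonal:
  assumes A: "group A" and a: "\<And>i. i < r \<Longrightarrow> isometric_action A (L i) (a i)"
  shows "isometric_action A (l1_product r L) (diagonal_action r a L)"
proof -
  interpret A: group A by (rule A)
  have closed: "diagonal_action r a L g x \<in> mspace (l1_product r L)"
    if "g \<in> carrier A" "x \<in> mspace (l1_product r L)" for g x
    using that isometric_actionD(1)[OF a] by (auto simp: diagonal_action_def)
  show ?thesis
  proof (rule isometric_actionI[OF A closed])
    fix g h x assume g: "g \<in> carrier A" and h: "h \<in> carrier A" and x: "x \<in> mspace (l1_product r L)"
    show "diagonal_action r a L (g \<otimes>\<^bsub>A\<^esub> h) x = diagonal_action r a L g (diagonal_action r a L h x)"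
      using g h x closed[OF h x] isometric_actionD(3)[OF a]
      by (auto simp: diagonal_action_def PiE_iff fun_eq_iff)
  next
    fix x assume "x \<in> mspace (l1_product r L)"
    then show "diagonal_action r a L \<one>\<^bsub>A\<^esub> x = x"
      using isometric_actionD(4)[OF a]
      by (auto simp: diagonal_action_def PiE_iff fun_eq_iff extensional_def)
  next
    fix g x y assume "g \<in> carrier A" "x \<in> mspace (l1_product r L)" "y \<in> mspace (l1_product r L)"
    then show "mdist (l1_product r L) (diagonal_action r a L g x) (diagonal_action r a L g y)
        = mdist (l1_product r L) x y"
      using isometric_actionD(5)[OF a] by (auto simp: diagonal_action_def PiE_iff intro!: sum.cong)
  next
    fix g
    show "diagonal_action r a L g \<in> extensional (mspace (l1_product r L))"
      unfolding diagonal_action_def mspace_l1_product by (rule restrict_extensional)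
  qed
qed

text \<open>Send \<open>e\<close> to some \<open>z\<close> moving the base point close to where \<open>e\<close> moves it: as \<open>z\<close> commutes with
  \<open>E\<close>, the errors of two such choices add up.\<close>

lemma (in central_extension) geometric_imp_quasi_retraction:
  assumes \<phi>: "isometric_action E M \<phi>" and geo: "geometric_action Z M (\<lambda>z. \<phi> (\<iota> z))"
  shows "\<exists>\<psi>. quasi_retraction Z E \<iota> \<psi>"
proof -
  interpret Z: comm_group Z by (rule Z_comm)
  note act = isometric_actionD[OF \<phi>]
  obtain x \<epsilon> where x: "x \<in> mspace M" and \<epsilon>: "\<epsilon> \<ge> 0"
    and dense: "\<And>y. y \<in> mspace M \<Longrightarrow> \<exists>z\<in>carrier Z. mdist M y (\<phi> (\<iota> z) x) \<le> \<epsilon>"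
    using geo by (auto simp: geometric_action_def cobounded_action_def)
  define p where "p e = (SOME z. z \<in> carrier Z \<and> mdist M (\<phi> e x) (\<phi> (\<iota> z) x) \<le> \<epsilon>)" for e
  have p: "p e \<in> carrier Z \<and> mdist M (\<phi> e x) (\<phi> (\<iota> (p e)) x) \<le> \<epsilon>" if "e \<in> carrier E" for e
    unfolding p_def by (rule someI_ex) (use dense[of "\<phi> e x"] that x act(1) in blast)
  define \<psi> where "\<psi> e = (if e \<in> \<iota> ` carrier Z then inv_into (carrier Z) \<iota> e else p e)" for e
  have \<psi>\<iota>: "\<psi> (\<iota> z) = z" if "z \<in> carrier Z" for z
    using that iota_inj by (simp add: \<psi>_def)
  have \<psi>c: "\<psi> e \<in> carrier Z" and near: "mdist M (\<phi> e x) (\<phi> (\<iota> (\<psi> e)) x) \<le> \<epsilon>"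
    if e: "e \<in> carrier E" for e
  proof -
    have "\<psi> e \<in> carrier Z \<and> mdist M (\<phi> e x) (\<phi> (\<iota> (\<psi> e)) x) \<le> \<epsilon>"
    proof (cases "e \<in> \<iota> ` carrier Z")
      case True
      then obtain z where z: "z \<in> carrier Z" "e = \<iota> z" by blast
      then show ?thesis
        using \<psi>\<iota> \<epsilon> mdist_zero[of "\<phi> e x" M "\<phi> e x"] act(1)[OF e x] by (metis order_refl)
    next
      case False
      then show ?thesis using p[OF e] by (simp add: \<psi>_def)
    qed
    then show "\<psi> e \<in> carrier Z" "mdist M (\<phi> e x) (\<phi> (\<iota> (\<psi> e)) x) \<le> \<epsilon>" by simp_all
  qed
  have defect: "mdist M x (\<phi> (\<iota> (inv\<^bsub>Z\<^esub> (\<psi> h) \<otimes>\<^bsub>Z\<^esub> inv\<^bsub>Z\<^esub> (\<psi> g) \<otimes>\<^bsub>Z\<^esub> \<psi> (g \<otimes>\<^bsub>E\<^esub> h))) x) \<le> 3 * \<epsilon>"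
    if g: "g \<in> carrier E" and h: "h \<in> carrier E" for g h
  proof -
    let ?a = "\<psi> g" and ?b = "\<psi> h" and ?c = "\<psi> (g \<otimes>\<^bsub>E\<^esub> h)"
    let ?d = "inv\<^bsub>Z\<^esub> ?b \<otimes>\<^bsub>Z\<^esub> inv\<^bsub>Z\<^esub> ?a \<otimes>\<^bsub>Z\<^esub> ?c"
    have gh: "g \<otimes>\<^bsub>E\<^esub> h \<in> carrier E" using g h by simp
    note c = \<psi>c[OF g] \<psi>c[OF h] \<psi>c[OF gh]
    have pts: "\<phi> e x \<in> mspace M" if "e \<in> carrier E" for e using act(1) x that by blast
    have "?a \<otimes>\<^bsub>Z\<^esub> ?b \<otimes>\<^bsub>Z\<^esub> ?d = ?c"
      using c Z.r_inv[of "?a \<otimes>\<^bsub>Z\<^esub> ?b"] by (simp add: Z.inv_mult_group flip: Z.m_assoc)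
    then have "\<phi> (\<iota> (?a \<otimes>\<^bsub>Z\<^esub> ?b)) (\<phi> (\<iota> ?d) x) = \<phi> (\<iota> ?c) x"
      using act(3)[of "\<iota> (?a \<otimes>\<^bsub>Z\<^esub> ?b)" "\<iota> ?d" x] c x by (metis Z.inv_closed Z.m_closed iota.hom_closed iota.hom_mult)
    then have "mdist M x (\<phi> (\<iota> ?d) x) = mdist M (\<phi> (\<iota> (?a \<otimes>\<^bsub>Z\<^esub> ?b)) x) (\<phi> (\<iota> ?c) x)"
      using act(5)[of "\<iota> (?a \<otimes>\<^bsub>Z\<^esub> ?b)" x "\<phi> (\<iota> ?d) x"] c x pts[of "\<iota> ?d"] by (metis Z.inv_closed Z.m_closed iota.hom_closed)
    \<comment> \<open>The path runs from \<open>a b x\<close> over \<open>g b x\<close> and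
      \<open>g h x\<close> to \<open>c x\<close>, where a, b, c are the images of g, h and gh under
      \<open>\<psi>\<close>; each leg is at most \<open>\<epsilon>\<close>.\<close>
    also have "\<dots> \<le> mdist M (\<phi> (\<iota> (?a \<otimes>\<^bsub>Z\<^esub> ?b)) x) (\<phi> (g \<otimes>\<^bsub>E\<^esub> h) x)
        + mdist M (\<phi> (g \<otimes>\<^bsub>E\<^esub> h) x) (\<phi> (\<iota> ?c) x)"
      by (rule mdist_triangle) (use c gh pts in auto)
    also have "mdist M (\<phi> (\<iota> (?a \<otimes>\<^bsub>Z\<^esub> ?b)) x) (\<phi> (g \<otimes>\<^bsub>E\<^esub> h) x)
        \<le> mdist M (\<phi> (\<iota> (?a \<otimes>\<^bsub>Z\<^esub> ?b)) x) (\<phi> (g \<otimes>\<^bsub>E\<^esub> \<iota> ?b) x)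
        + mdist M (\<phi> (g \<otimes>\<^bsub>E\<^esub> \<iota> ?b) x) (\<phi> (g \<otimes>\<^bsub>E\<^esub> h) x)"
      by (rule mdist_triangle) (use c g h pts in auto)
    also have "mdist M (\<phi> (\<iota> (?a \<otimes>\<^bsub>Z\<^esub> ?b)) x) (\<phi> (g \<otimes>\<^bsub>E\<^esub> \<iota> ?b) x)
        = mdist M (\<phi> (\<iota> ?b) (\<phi> (\<iota> ?a) x)) (\<phi> (\<iota> ?b) (\<phi> g x))"
    proof -
      \<comment> \<open>Here centrality acts: \<open>b\<close> is pulled to the left of both
        \<open>a\<close> and \<open>g\<close>, where it is an isometry that cancels from the
        distance.\<close>
      have "\<iota> (?a \<otimes>\<^bsub>Z\<^esub> ?b) = \<iota> ?b \<otimes>\<^bsub>E\<^esub> \<iota> ?a" using c Z.m_comm[of ?a ?b] by simp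
      moreover have "g \<otimes>\<^bsub>E\<^esub> \<iota> ?b = \<iota> ?b \<otimes>\<^bsub>E\<^esub> g" using central[OF c(2) g] by simp
      ultimately show ?thesis using c g x act(3) by simp
    qed
    also have "\<dots> = mdist M (\<phi> g x) (\<phi> (\<iota> ?a) x)"
      using act(5)[of "\<iota> ?b" "\<phi> (\<iota> ?a) x" "\<phi> g x"] c g pts by (simp add: mdist_commute)
    also have "mdist M (\<phi> (g \<otimes>\<^bsub>E\<^esub> \<iota> ?b) x) (\<phi> (g \<otimes>\<^bsub>E\<^esub> h) x) = mdist M (\<phi> h x) (\<phi> (\<iota> ?b) x)"
      using act(3,5) c g h x pts by (simp add: mdist_commute)
    finally show ?thesis using near[OF g] near[OF h] near[OF gh] by linarith
  qed
  have "quasi_hom E Z \<psi>"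
    unfolding quasi_hom_def
  proof
    show "\<psi> \<in> carrier E \<rightarrow> carrier Z" using \<psi>c by blast
    \<comment> \<open>The summand 1 is there because properness speaks of positive radii, while
      \<open>\<epsilon>\<close> may be 0.\<close>
    have "finite {z \<in> carrier Z. mdist M x (\<phi> (\<iota> z) x) \<le> 3 * \<epsilon> + 1}"
      using geo x \<epsilon> by (simp add: geometric_action_def proper_action_def)
    moreover have "{inv\<^bsub>Z\<^esub> (\<psi> h) \<otimes>\<^bsub>Z\<^esub> inv\<^bsub>Z\<^esub> (\<psi> g) \<otimes>\<^bsub>Z\<^esub> \<psi> (g \<otimes>\<^bsub>E\<^esub> h) | g h.
        g \<in> carrier E \<and> h \<in> carrier E} \<subseteq> {z \<in> carrier Z. mdist M x (\<phi> (\<iota> z) x) \<le> 3 * \<epsilon> + 1}"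
      using \<psi>c defect by (auto intro!: order_trans[OF defect])
    ultimately show "finite {inv\<^bsub>Z\<^esub> (\<psi> h) \<otimes>\<^bsub>Z\<^esub> inv\<^bsub>Z\<^esub> (\<psi> g) \<otimes>\<^bsub>Z\<^esub> \<psi> (g \<otimes>\<^bsub>E\<^esub> h) | g h.
        g \<in> carrier E \<and> h \<in> carrier E}"
      by (rule finite_subset[rotated])
  qed
  then show ?thesis using \<psi>\<iota> by (auto simp: quasi_retraction_def)
qed


section \<open>Rough lines\<close>

text \<open>The one-step partition bounds the length of any path below by the distance of its ends.
  Along the given Lipschitz path all partition sums telescope to at most that distance.\<close>

lemma is_path_metric_if_geodesic:
  assumes "\<And>x y. \<lbrakk>x \<in> mspace M; y \<in> mspace M\<rbrakk> \<Longrightarrow> \<exists>\<gamma>. \<gamma> 0 = x \<and> \<gamma> 1 = y \<and>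
    \<gamma> \<in> {0..1} \<rightarrow> mspace M \<and>
    (\<forall>s\<in>{0..1}. \<forall>t\<in>{0..1}. mdist M (\<gamma> s) (\<gamma> t) \<le> \<bar>s - t\<bar> * mdist M x y)"
  shows "is_path_metric M"
  unfolding is_path_metric_def
proof (intro ballI antisym)
  fix x y assume x: "x \<in> mspace M" and y: "y \<in> mspace M"
  let ?P = "{\<gamma>. pathin (mtopology_of M) \<gamma> \<and> \<gamma> 0 = x \<and> \<gamma> 1 = y}"
  show "ennreal (mdist M x y) \<le> (INF \<gamma>\<in>?P. path_length M \<gamma>)"
  proof (rule INF_greatest)
    fix \<gamma> assume "\<gamma> \<in> ?P"
    then show "ennreal (mdist M x y) \<le> path_length M \<gamma>"
      unfolding path_length_def
      by (intro SUP_upper2[of "(1, real)"]) (auto simp: mono_on_def)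
  qed
  obtain \<gamma> where \<gamma>: "\<gamma> 0 = x" "\<gamma> 1 = y" "\<gamma> \<in> {0..1} \<rightarrow> mspace M"
    and lip: "\<And>s t. \<lbrakk>s \<in> {0..1}; t \<in> {0..1}\<rbrakk> \<Longrightarrow> mdist M (\<gamma> s) (\<gamma> t) \<le> \<bar>s - t\<bar> * mdist M x y"
    using assms[OF x y] by blast
  have "Lipschitz_continuous_map (submetric euclidean_metric {0..1}) M \<gamma>"
    unfolding Lipschitz_continuous_map_def
    using \<gamma>(3) lip by (auto simp: dist_real_def mult.commute intro!: exI[of _ "mdist M x y"])
  then have "pathin (mtopology_of M) \<gamma>"
    using Lipschitz_continuous_imp_continuous_map
    by (fastforce simp: pathin_def mtopology_of_submetric)
  then have "\<gamma> \<in> ?P" using \<gamma> by simp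
  then have "(INF \<gamma>\<in>?P. path_length M \<gamma>) \<le> path_length M \<gamma>" by (rule INF_lower)
  also have "\<dots> \<le> ennreal (mdist M x y)"
    unfolding path_length_def
  proof (rule SUP_least, clarify, rule ennreal_leI)
    fix n :: nat and t :: "nat \<Rightarrow> real"
    assume mono: "mono_on {..n} t" and t: "t 0 = 0" "t n = 1"
    have "t i \<in> {0..1}" if "i \<le> n" for i
      using mono_onD[OF mono, of 0 i] mono_onD[OF mono, of i n] that t by simp
    moreover have "t i \<le> t (Suc i)" if "i < n" for i
      using mono_onD[OF mono, of i "Suc i"] that by simp
    ultimately have "(\<Sum>i<n. mdist M (\<gamma> (t i)) (\<gamma> (t (Suc i)))) \<le>
        (\<Sum>i<n. (t (Suc i) - t i) * mdist M x y)"
      by (intro sum_mono order_trans[OF lip]) auto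
    also have "\<dots> = mdist M x y"
      using t by (simp add: sum_lessThan_telescope flip: sum_distrib_right)
    finally show "(\<Sum>i<n. mdist M (\<gamma> (t i)) (\<gamma> (t (Suc i)))) \<le> mdist M x y" .
  qed
  finally show "(INF \<gamma>\<in>?P. path_length M \<gamma>) \<le> ennreal (mdist M x y)" .
qed

text \<open>The Gromov product of the real line at base point 0: the smaller absolute value if the
  signs agree, and 0 otherwise.\<close>

definition line_product :: "real \<Rightarrow> real \<Rightarrow> real" where
  "line_product a b = (\<bar>a\<bar> + \<bar>b\<bar> - \<bar>a - b\<bar>) / 2"

lemma line_product_same_sign:
  assumes "line_product a b > 0"
  shows "a > 0 \<longleftrightarrow> b > 0" "a < 0 \<longleftrightarrow> b < 0" "line_product a b \<le> \<bar>a\<bar>" "line_product a b \<le> \<bar>b\<bar>"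
    "a \<noteq> 0"
  using assms by (auto simp: line_product_def abs_if split: if_splits)

lemma line_product_ge:
  assumes "K \<le> a \<and> K \<le> b \<or> a \<le> - K \<and> b \<le> - K"
  shows "K \<le> line_product a b"
  using assms by (auto simp: line_product_def abs_if)

text \<open>The real line is hyperbolic with constant 0.\<close>

lemma line_product_min: "min (line_product a b) (line_product b c) \<le> line_product a c"
  by (auto simp: line_product_def min_def abs_if field_simps)

text \<open>The comparison map \<open>u\<close> has an additive error only. A multiplicative
  constant would distort Gromov products without bound; here they are those of the line up to half
  of three errors \<open>C\<close>.\<close>

locale rough_line =
  fixes M :: "'a metric" and u :: "'a \<Rightarrow> real" and C :: real
  assumes rough: "\<lbrakk>x \<in> mspace M; y \<in> mspace M\<rbrakk> \<Longrightarrow> \<bar>mdist M x y - \<bar>u x - u y\<bar>\<bar> \<le> C"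
    and onto: "\<exists>x\<in>mspace M. u x = t"
begin

lemma C_nonneg: "C \<ge> 0"
proof -
  obtain x where x: "x \<in> mspace M" using onto by blast
  then have "mdist M x x = 0" by simp
  then have "\<bar>0 - \<bar>u x - u x\<bar>\<bar> \<le> C" using rough[OF x x] by metis
  then show ?thesis by simp
qed

lemma quasi_isometric_real: "quasi_isometric M (euclidean_metric :: real metric)"
  unfolding quasi_isometric_def
proof (rule exI[of _ u], rule exI[of _ 1], rule exI[of _ C], intro conjI ballI)
  fix x y assume "x \<in> mspace M" "y \<in> mspace M"
  note rough[OF this]
  then show "mdist M x y / 1 - C \<le> mdist euclidean_metric (u x) (u y)"
    "mdist euclidean_metric (u x) (u y) \<le> 1 * mdist M x y + C"
    by (simp_all add: dist_real_def)
next
  fix t :: real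
  obtain x where "x \<in> mspace M" "u x = t" using onto by blast
  then show "\<exists>x\<in>mspace M. mdist euclidean_metric t (u x) \<le> C"
    using C_nonneg by (auto intro!: bexI[of _ x])
qed (use C_nonneg in auto)

lemma gromov_product_rough:
  assumes "p \<in> mspace M" "x \<in> mspace M" "y \<in> mspace M"
  shows "gromov_product M p x y \<le> line_product (u x - u p) (u y - u p) + 3 / 2 * C"
    and "line_product (u x - u p) (u y - u p) \<le> gromov_product M p x y + 3 / 2 * C"
proof -
  have "(d + d' - d'') / 2 \<le> (a + a' - a'') / 2 + 3 / 2 * C"
    "(a + a' - a'') / 2 \<le> (d + d' - d'') / 2 + 3 / 2 * C"
    if "\<bar>d - a\<bar> \<le> C" "\<bar>d' - a'\<bar> \<le> C" "\<bar>d'' - a''\<bar> \<le> C" for d d' d'' a a' a'' :: real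
    using that by (auto simp: abs_le_iff field_simps)
  from this[OF rough[OF assms(2,1)] rough[OF assms(3,1)] rough[OF assms(2,3)]]
  show "gromov_product M p x y \<le> line_product (u x - u p) (u y - u p) + 3 / 2 * C"
    "line_product (u x - u p) (u y - u p) \<le> gromov_product M p x y + 3 / 2 * C"
    by (simp_all add: gromov_product_def line_product_def)
qed

section \<open>Hyperbolicity and Gromov boundary of a rough line\<close>

lemma gromov_hyperbolic: "gromov_hyperbolic M"
  unfolding gromov_hyperbolic_def
proof (intro exI[of _ "3 * C"] conjI ballI)
  fix p x y z assume m: "p \<in> mspace M" "x \<in> mspace M" "y \<in> mspace M" "z \<in> mspace M"
  show "min (gromov_product M p x y) (gromov_product M p y z) - 3 * C \<le> gromov_product M p x z"
    using line_product_min[of "u x - u p" "u y - u p" "u z - u p"]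
      gromov_product_rough(1)[OF m(1,2,3)] gromov_product_rough(1)[OF m(1,3,4)]
      gromov_product_rough(2)[OF m(1,2,4)] by linarith
qed (use C_nonneg in simp)

text \<open>A positive product on the line forces equal signs. Since the two indices vary
  independently, comparison with the single entry at \<open>N\<close> fixes the sign of both tails,
  and large products then make all absolute values large.\<close>

lemma gromov_product_to_infinity_iff:
  assumes x: "range x \<subseteq> mspace M" and y: "range y \<subseteq> mspace M"
  shows "gromov_product_to_infinity M x y \<longleftrightarrow>
    filterlim (u \<circ> x) at_top sequentially \<and> filterlim (u \<circ> y) at_top sequentially \<or>
    filterlim (u \<circ> x) at_bot sequentially \<and> filterlim (u \<circ> y) at_bot sequentially"
proof
  assume inf: "gromov_product_to_infinity M x y"
  obtain p where p: "p \<in> mspace M" "u p = 0" using onto by blast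
  have large: "\<exists>N. \<forall>m\<ge>N. \<forall>n\<ge>N. K \<le> line_product (u (x n)) (u (y m))" for K
  proof -
    have "eventually (\<lambda>(i, j). K + 3 / 2 * C \<le> gromov_product M p (x i) (y j))
        (sequentially \<times>\<^sub>F sequentially)"
      using inf p(1) unfolding gromov_product_to_infinity_def filterlim_at_top
      by (simp add: case_prod_unfold)
    then obtain N where N: "\<forall>m\<ge>N. \<forall>n\<ge>N. K + 3 / 2 * C \<le> gromov_product M p (x n) (y m)"
      by (auto simp: eventually_prod_sequentially)
    have "K \<le> line_product (u (x n)) (u (y m))" if "m \<ge> N" "n \<ge> N" for m n
    proof -
      have "x n \<in> mspace M" "y m \<in> mspace M" using x y by auto
      then show ?thesis
        using gromov_product_rough(1)[OF p(1), of "x n" "y m"] N that by (fastforce simp: p(2))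
    qed
    then show ?thesis by blast
  qed
  obtain N where N: "\<And>m n. \<lbrakk>m \<ge> N; n \<ge> N\<rbrakk> \<Longrightarrow>
      1 \<le> line_product (u (x n)) (u (y m))"
    using large[of 1] by blast
  show "filterlim (u \<circ> x) at_top sequentially \<and> filterlim (u \<circ> y) at_top sequentially \<or>
    filterlim (u \<circ> x) at_bot sequentially \<and> filterlim (u \<circ> y) at_bot sequentially"
  proof (cases "u (x N) > 0")
    case True
    then have sy: "u (y m) > 0" if "m \<ge> N" for m
      using line_product_same_sign[of "u (x N)" "u (y m)"] N[OF that, of N] by fastforce
    then have sx: "u (x n) > 0" if "n \<ge> N" for n
      using line_product_same_sign[of "u (x n)" "u (y N)"] N[OF _ that, of N] sy[of N] by fastforce
    have "\<exists>N. \<forall>n\<ge>N. K \<le> u (x n) \<and> K \<le> u (y n)" for K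
    proof -
      obtain N' where N': "\<And>m n. \<lbrakk>m \<ge> N'; n \<ge> N'\<rbrakk> \<Longrightarrow>
        K \<le> line_product (u (x n)) (u (y m))"
        using large[of K] by blast
      have "K \<le> u (x n) \<and> K \<le> u (y n)" if n: "n \<ge> max N N'" for n
      proof -
        have "line_product (u (x n)) (u (y n)) > 0" using N[of n n] n by simp
        then show ?thesis
          using line_product_same_sign(3,4)[of "u (x n)" "u (y n)"] N'[of n n] sx[of n] sy[of n] n
          by simp
      qed
      then show ?thesis by blast
    qed
    then show ?thesis unfolding filterlim_at_top eventually_sequentially comp_def by meson
  next
    case False
    then have sy: "u (y m) < 0" if "m \<ge> N" for m
      using line_product_same_sign[of "u (x N)" "u (y m)"] N[OF that, of N] by fastforce
    then have sx: "u (x n) < 0" if "n \<ge> N" for n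
      using line_product_same_sign[of "u (x n)" "u (y N)"] N[OF _ that, of N] sy[of N] by fastforce
    have "\<exists>N. \<forall>n\<ge>N. u (x n) \<le> K \<and> u (y n) \<le> K" for K
    proof -
      obtain N' where N': "\<And>m n. \<lbrakk>m \<ge> N'; n \<ge> N'\<rbrakk> \<Longrightarrow>
        - K \<le> line_product (u (x n)) (u (y m))"
        using large[of "- K"] by blast
      have "u (x n) \<le> K \<and> u (y n) \<le> K" if n: "n \<ge> max N N'" for n
      proof -
        have "line_product (u (x n)) (u (y n)) > 0" using N[of n n] n by simp
        then show ?thesis
          using line_product_same_sign(3,4)[of "u (x n)" "u (y n)"] N'[of n n] sx[of n] sy[of n] n
          by simp
      qed
      then show ?thesis by blast
    qed
    then show ?thesis unfolding filterlim_at_bot eventually_sequentially comp_def by meson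
  qed
next
  assume lim: "filterlim (u \<circ> x) at_top sequentially \<and> filterlim (u \<circ> y) at_top sequentially \<or>
    filterlim (u \<circ> x) at_bot sequentially \<and> filterlim (u \<circ> y) at_bot sequentially"
  show "gromov_product_to_infinity M x y"
    unfolding gromov_product_to_infinity_def filterlim_at_top
  proof (intro ballI allI)
    fix p K assume p: "p \<in> mspace M"
    \<comment> \<open>Absorbs the move of the base point from 0 to \<open>u p\<close> and the error
      of the Gromov product.\<close>
    define K' where "K' = \<bar>K\<bar> + \<bar>u p\<bar> + 3 / 2 * C"
    have "\<exists>N. \<forall>m\<ge>N. \<forall>n\<ge>N.
      (K' \<le> u (x n) \<and> K' \<le> u (y m)) \<or> (u (x n) \<le> - K' \<and> u (y m) \<le> - K')"
      using lim
    proof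
      assume "filterlim (u \<circ> x) at_top sequentially \<and> filterlim (u \<circ> y) at_top sequentially"
      then obtain N1 N2 where "\<forall>n\<ge>N1. K' \<le> u (x n)" "\<forall>n\<ge>N2. K' \<le> u (y n)"
        unfolding filterlim_at_top eventually_sequentially comp_def by metis
      then show ?thesis by (intro exI[of _ "max N1 N2"]) auto
    next
      assume "filterlim (u \<circ> x) at_bot sequentially \<and> filterlim (u \<circ> y) at_bot sequentially"
      then obtain N1 N2 where "\<forall>n\<ge>N1. u (x n) \<le> - K'" "\<forall>n\<ge>N2. u (y n) \<le> - K'"
        unfolding filterlim_at_bot eventually_sequentially comp_def by metis
      then show ?thesis by (intro exI[of _ "max N1 N2"]) auto
    qed
    then obtain N where N: "\<And>m n. \<lbrakk>m \<ge> N; n \<ge> N\<rbrakk> \<Longrightarrow>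
      (K' \<le> u (x n) \<and> K' \<le> u (y m)) \<or> (u (x n) \<le> - K' \<and> u (y m) \<le> - K')" by blast
    have "K \<le> gromov_product M p (x n) (y m)" if "m \<ge> N" "n \<ge> N" for m n
    proof -
      have "x n \<in> mspace M" "y m \<in> mspace M" using x y by auto
      then have "line_product (u (x n) - u p) (u (y m) - u p) \<le>
          gromov_product M p (x n) (y m) + 3 / 2 * C"
        by (rule gromov_product_rough(2)[OF p])
      moreover have "K + 3 / 2 * C \<le> line_product (u (x n) - u p) (u (y m) - u p)"
        by (rule line_product_ge) (use N[OF that] C_nonneg in \<open>unfold K'_def, linarith\<close>)
      ultimately show ?thesis by linarith
    qed
    then show "eventually (\<lambda>q. K \<le> (case q of (i, j) \<Rightarrow> gromov_product M p (x i) (y j)))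
        (sequentially \<times>\<^sub>F sequentially)"
      by (auto simp: eventually_prod_sequentially)
  qed
qed

definition line_end :: "real filter \<Rightarrow> (nat \<Rightarrow> 'a) set" where
  "line_end F = {x. range x \<subseteq> mspace M \<and> filterlim (u \<circ> x) F sequentially}"

lemma line_ends_disjoint: "line_end at_top \<inter> line_end at_bot = {}"
  using filterlim_at_top_at_bot[of _ sequentially] by (auto simp: line_end_def)

lemma line_end_nonempty: "line_end at_top \<noteq> {}" "line_end at_bot \<noteq> {}"
proof -
  have "\<forall>t. \<exists>x. x \<in> mspace M \<and> u x = t" using onto by blast
  then obtain v where v: "\<And>t. v t \<in> mspace M \<and> u (v t) = t" by metis
  have "(\<lambda>n. v (real n)) \<in> line_end at_top"
    using v by (auto simp: line_end_def comp_def filterlim_real_sequentially)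
  then show "line_end at_top \<noteq> {}" by blast
  have "(\<lambda>n. v (- real n)) \<in> line_end at_bot"
    using v by (auto simp: line_end_def comp_def filterlim_uminus_at_bot filterlim_real_sequentially)
  then show "line_end at_bot \<noteq> {}" by blast
qed

text \<open>Sequences converging to the boundary are those tending to one of the two ends, and the
  relation on them is the union of two disjoint squares, hence has two classes.\<close>

lemma gromov_boundary_eq: "gromov_boundary M = {line_end at_top, line_end at_bot}"
proof -
  have seqs: "boundary_sequences M = line_end at_top \<union> line_end at_bot"
    using gromov_product_to_infinity_iff by (auto simp: boundary_sequences_def line_end_def)
  have rel: "boundary_rel M = line_end at_top \<times> line_end at_top \<union> line_end at_bot \<times> line_end at_bot"
    using gromov_product_to_infinity_iff
    by (auto simp: boundary_rel_def boundary_sequences_def line_end_def)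
  have "boundary_rel M `` {x} = line_end at_top" if "x \<in> line_end at_top" for x
    using that line_ends_disjoint by (auto simp: rel)
  moreover have "boundary_rel M `` {x} = line_end at_bot" if "x \<in> line_end at_bot" for x
    using that line_ends_disjoint by (auto simp: rel)
  ultimately have cls: "boundary_rel M `` {x} =
      (if x \<in> line_end at_top then line_end at_top else line_end at_bot)"
    if "x \<in> boundary_sequences M" for x
    using that by (auto simp: seqs)
  obtain a b where ab: "a \<in> line_end at_top" "b \<in> line_end at_bot"
    using line_end_nonempty by blast
  then have "b \<notin> line_end at_top" using line_ends_disjoint by blast
  show ?thesis
  proof
    show "gromov_boundary M \<subseteq> {line_end at_top, line_end at_bot}"
    proof
      fix \<xi> assume "\<xi> \<in> gromov_boundary M"
      then obtain x where "x \<in> boundary_sequences M" "\<xi> = boundary_rel M `` {x}"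
        unfolding gromov_boundary_def by (rule quotientE)
      then show "\<xi> \<in> {line_end at_top, line_end at_bot}" by (simp add: cls)
    qed
    have "boundary_rel M `` {x} \<in> gromov_boundary M" if "x \<in> boundary_sequences M" for x
      using that by (simp add: gromov_boundary_def quotientI)
    from this[of a] this[of b] show "{line_end at_top, line_end at_bot} \<subseteq> gromov_boundary M"
      using ab \<open>b \<notin> line_end at_top\<close> by (simp add: cls seqs)
  qed
qed

lemma card_gromov_boundary: "card (gromov_boundary M) = 2"
  using line_ends_disjoint line_end_nonempty by (auto simp: gromov_boundary_eq card_2_iff)

text \<open>Bounded displacement does not affect divergence to either end. Only an inclusion can be
  claimed, as \<open>f\<close> is not assumed to be onto.\<close>

lemma boundary_map_subset:
  assumes f: "f \<in> mspace M \<rightarrow> mspace M" and B: "\<And>x. x \<in> mspace M \<Longrightarrow> \<bar>u (f x) - u x\<bar> \<le> B"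
    and \<xi>: "\<xi> \<in> gromov_boundary M"
  shows "boundary_map f \<xi> \<subseteq> \<xi>"
proof -
  have "f \<circ> x \<in> line_end at_top" if x: "x \<in> line_end at_top" for x
  proof -
    have m: "x n \<in> mspace M" for n using x by (auto simp: line_end_def)
    have "eventually (\<lambda>n. K \<le> u (f (x n))) sequentially" for K
    proof (rule eventually_mono)
      show "eventually (\<lambda>n. K + B \<le> u (x n)) sequentially"
        using x by (simp add: line_end_def filterlim_at_top)
      show "K \<le> u (f (x n))" if "K + B \<le> u (x n)" for n using B[OF m[of n]] that by linarith
    qed
    then have "filterlim (u \<circ> (f \<circ> x)) at_top sequentially" by (simp add: filterlim_at_top)
    then show ?thesis using f m by (auto simp: line_end_def)
  qed
  moreover have "f \<circ> x \<in> line_end at_bot" if x: "x \<in> line_end at_bot" for x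
  proof -
    have m: "x n \<in> mspace M" for n using x by (auto simp: line_end_def)
    have "eventually (\<lambda>n. u (f (x n)) \<le> K) sequentially" for K
    proof (rule eventually_mono)
      show "eventually (\<lambda>n. u (x n) \<le> K - B) sequentially"
        using x by (simp add: line_end_def filterlim_at_bot)
      show "u (f (x n)) \<le> K" if "u (x n) \<le> K - B" for n using B[OF m[of n]] that by linarith
    qed
    then have "filterlim (u \<circ> (f \<circ> x)) at_bot sequentially" by (simp add: filterlim_at_bot)
    then show ?thesis using f m by (auto simp: line_end_def)
  qed
  ultimately show ?thesis using \<xi> by (auto simp: gromov_boundary_eq boundary_map_def)
qed

text \<open>Each element fixes both ends, although the bound \<open>B g\<close> may depend on it. So
  all fixed-point sets are the whole boundary, nothing is swapped, and being loxodromic reduces to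
  not being elliptic. The assumption \<open>far\<close> treats every base point, since an elliptic
  element needs just one bounded orbit.\<close>

lemma orientable_lineal_if_bounded_displacement:
  assumes A: "group A" and \<phi>: "isometric_action A M \<phi>"
    and B: "\<And>g x. \<lbrakk>g \<in> carrier A; x \<in> mspace M\<rbrakk> \<Longrightarrow> \<bar>u (\<phi> g x) - u x\<bar> \<le> B g"
    and far: "\<exists>g\<in>carrier A. \<forall>x\<in>mspace M. \<forall>K. \<exists>n::int. \<bar>u (\<phi> (g [^]\<^bsub>A\<^esub> n) x) - u x\<bar> > K"
  shows "orientable_lineal_action A M \<phi>"
proof -
  interpret A: group A by (rule A)
  note act = isometric_actionD[OF \<phi>]
  have fix_ends: "boundary_map (\<phi> g) \<xi> = \<xi>" if g: "g \<in> carrier A" and \<xi>: "\<xi> \<in> gromov_boundary M" for g \<xi>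
  proof
    have sub: "boundary_map (\<phi> h) \<xi> \<subseteq> \<xi>" if "h \<in> carrier A" for h
      using boundary_map_subset[of "\<phi> h" "B h", OF _ B \<xi>] act(1) that by blast
    show "boundary_map (\<phi> g) \<xi> \<subseteq> \<xi>" by (rule sub[OF g])
    \<comment> \<open>The reverse inclusion is the same bound applied to the inverse of
      \<open>g\<close>.\<close>
    show "\<xi> \<subseteq> boundary_map (\<phi> g) \<xi>"
    proof
      fix x assume x: "x \<in> \<xi>"
      then have "range x \<subseteq> mspace M" using \<xi> by (auto simp: gromov_boundary_eq line_end_def)
      then have "\<phi> g \<circ> (\<phi> (inv\<^bsub>A\<^esub> g) \<circ> x) = x"
        using act(3)[of g "inv\<^bsub>A\<^esub> g"] act(4) g by (auto simp: fun_eq_iff image_subset_iff)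
      moreover have "\<phi> (inv\<^bsub>A\<^esub> g) \<circ> x \<in> \<xi>"
        using sub[of "inv\<^bsub>A\<^esub> g"] g x by (auto simp: boundary_map_def)
      ultimately show "x \<in> boundary_map (\<phi> g) \<xi>" unfolding boundary_map_def by (metis imageI)
    qed
  qed
  have fixpts: "boundary_fixpoints M (\<phi> g) = gromov_boundary M" if "g \<in> carrier A" for g
    using fix_ends[OF that] by (auto simp: boundary_fixpoints_def)
  obtain g where g: "g \<in> carrier A"
    and gfar: "\<And>x K. x \<in> mspace M \<Longrightarrow> \<exists>n::int. \<bar>u (\<phi> (g [^]\<^bsub>A\<^esub> n) x) - u x\<bar> > K"
    using far by blast
  interpret M: Metric_space "mspace M" "mdist M" by (rule Metric_space_mspace_mdist)
  have "\<not> elliptic A M \<phi> g"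
  proof
    assume "elliptic A M \<phi> g"
    then obtain x K where x: "x \<in> mspace M"
      and K: "\<And>y z. \<lbrakk>y \<in> {\<phi> (g [^]\<^bsub>A\<^esub> n) x | n::int. True}; z \<in> {\<phi> (g [^]\<^bsub>A\<^esub> n) x | n::int. True}\<rbrakk>
        \<Longrightarrow> mdist M y z \<le> K"
      unfolding elliptic_def M.mbounded_alt by blast
    obtain n :: int where n: "\<bar>u (\<phi> (g [^]\<^bsub>A\<^esub> n) x) - u x\<bar> > K + C" using gfar[OF x] by blast
    have "x = \<phi> (g [^]\<^bsub>A\<^esub> (0::int)) x" using act(4) x g by simp
    then have "mdist M (\<phi> (g [^]\<^bsub>A\<^esub> n) x) x \<le> K" by (intro K) blast+
    then show False
      using n rough[OF act(1)[of "g [^]\<^bsub>A\<^esub> n" x] x] g x by simp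
  qed
  then have "loxodromic A M \<phi> g"
    using fixpts[OF g] card_gromov_boundary by (simp add: loxodromic_def)
  then have "lineal_action A M \<phi>"
    using gromov_hyperbolic \<phi> g fixpts by (auto simp: lineal_action_def)
  then show ?thesis
    using fix_ends by (auto simp: orientable_lineal_action_def limit_points_def)
qed

end


section \<open>The quasi-line of a quasimorphism\<close>

text \<open>For a quasimorphism \<open>\<beta>\<close> with defect at most \<open>D\<close>, the functions at distance at most \<open>D\<close> from
  being \<open>\<beta>\<close>-equivariant form a convex set which is invariant under left translation and stays
  within bounded distance of the line \<open>{\<beta> + c}\<close>. Convexity makes the uniform metric geodesic.\<close>

definition near_equivariant :: "('a, 'm) monoid_scheme \<Rightarrow> real \<Rightarrow> ('a \<Rightarrow> real) \<Rightarrow> ('a \<Rightarrow> real) set" where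
  "near_equivariant A D \<beta> = {f \<in> extensional (carrier A).
     \<forall>x\<in>carrier A. \<forall>y\<in>carrier A. \<bar>f (x \<otimes>\<^bsub>A\<^esub> y) - f x - \<beta> y\<bar> \<le> D}"

definition sup_dist :: "('a, 'm) monoid_scheme \<Rightarrow> ('a \<Rightarrow> real) \<Rightarrow> ('a \<Rightarrow> real) \<Rightarrow> real" where
  "sup_dist A f h = (SUP x\<in>carrier A. \<bar>f x - h x\<bar>)"

text \<open>The metric space axioms include nonnegativity off the carrier, where the supremum is
  unspecified.\<close>

definition qm_dist :: "('a, 'm) monoid_scheme \<Rightarrow> real \<Rightarrow> ('a \<Rightarrow> real) \<Rightarrow>
    'l + ('a \<Rightarrow> real) \<Rightarrow> 'l + ('a \<Rightarrow> real) \<Rightarrow> real" where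
  "qm_dist A D \<beta> p q = (if p \<in> Inr ` near_equivariant A D \<beta> \<and> q \<in> Inr ` near_equivariant A D \<beta>
     then sup_dist A (projr p) (projr q) else 0)"

definition qm_line :: "('a, 'm) monoid_scheme \<Rightarrow> real \<Rightarrow> ('a \<Rightarrow> real) \<Rightarrow> ('l + ('a \<Rightarrow> real)) metric"
  where "qm_line A D \<beta> = metric (Inr ` near_equivariant A D \<beta>, qm_dist A D \<beta>)"

definition qm_action :: "('a, 'm) monoid_scheme \<Rightarrow> real \<Rightarrow> ('a \<Rightarrow> real) \<Rightarrow>
    'a \<Rightarrow> 'l + ('a \<Rightarrow> real) \<Rightarrow> 'l + ('a \<Rightarrow> real)" where
  "qm_action A D \<beta> g = (\<lambda>p\<in>Inr ` near_equivariant A D \<beta>.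
     Inr (\<lambda>x\<in>carrier A. projr p (inv\<^bsub>A\<^esub> g \<otimes>\<^bsub>A\<^esub> x)))"

locale quasimorphism_on = A: group A for A :: "('a, 'm) monoid_scheme" +
  fixes D :: real and \<beta> :: "'a \<Rightarrow> real"
  assumes quasimorphism: "quasimorphism A D \<beta>"
begin

lemma near_equivariantD:
  "\<lbrakk>f \<in> near_equivariant A D \<beta>; x \<in> carrier A; y \<in> carrier A\<rbrakk> \<Longrightarrow> \<bar>f (x \<otimes>\<^bsub>A\<^esub> y) - f x - \<beta> y\<bar> \<le> D"
  by (simp add: near_equivariant_def)

text \<open>Both functions change by \<open>\<beta> x\<close> up to \<open>D\<close> on the way from
  the identity to \<open>x\<close>. So values at the identity determine distances up to
  \<open>2 * D\<close>, and the supremum in \<open>sup_dist\<close> is finite.\<close>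

lemma near_equivariant_diff:
  assumes f: "f \<in> near_equivariant A D \<beta>" and h: "h \<in> near_equivariant A D \<beta>"
    and x: "x \<in> carrier A"
  shows "\<bar>(f x - h x) - (f \<one>\<^bsub>A\<^esub> - h \<one>\<^bsub>A\<^esub>)\<bar> \<le> 2 * D"
  using near_equivariantD[OF f A.one_closed x] near_equivariantD[OF h A.one_closed x] x by simp

lemma bdd_above_diff:
  assumes "f \<in> near_equivariant A D \<beta>" "h \<in> near_equivariant A D \<beta>"
  shows "bdd_above ((\<lambda>x. \<bar>f x - h x\<bar>) ` carrier A)"
proof (rule bdd_aboveI2)
  fix x assume "x \<in> carrier A"
  from near_equivariant_diff[OF assms this]
  show "\<bar>f x - h x\<bar> \<le> \<bar>f \<one>\<^bsub>A\<^esub> - h \<one>\<^bsub>A\<^esub>\<bar> + 2 * D" by linarith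
qed

lemma sup_dist_upper:
  "\<lbrakk>f \<in> near_equivariant A D \<beta>; h \<in> near_equivariant A D \<beta>; x \<in> carrier A\<rbrakk> \<Longrightarrow>
    \<bar>f x - h x\<bar> \<le> sup_dist A f h"
  unfolding sup_dist_def by (rule cSUP_upper[OF _ bdd_above_diff])

lemma sup_dist_least:
  "(\<And>x. x \<in> carrier A \<Longrightarrow> \<bar>f x - h x\<bar> \<le> K) \<Longrightarrow> sup_dist A f h \<le> K"
  unfolding sup_dist_def using A.one_closed by (intro cSUP_least) auto

lemma Metric_space_qm:
  "Metric_space (Inr ` near_equivariant A D \<beta> :: ('l + ('a \<Rightarrow> real)) set) (qm_dist A D \<beta>)"
proof
  fix p q :: "'l + ('a \<Rightarrow> real)"
  have "0 \<le> sup_dist A f h" if "f \<in> near_equivariant A D \<beta>" "h \<in> near_equivariant A D \<beta>" for f h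
    using sup_dist_upper[OF that A.one_closed] by linarith
  then show "0 \<le> qm_dist A D \<beta> p q" by (auto simp: qm_dist_def)
  show "qm_dist A D \<beta> p q = qm_dist A D \<beta> q p"
    by (auto simp: qm_dist_def sup_dist_def abs_minus_commute)
  assume p: "p \<in> Inr ` near_equivariant A D \<beta>" and q: "q \<in> Inr ` near_equivariant A D \<beta>"
  then obtain f h where f: "f \<in> near_equivariant A D \<beta>" "p = Inr f"
    and h: "h \<in> near_equivariant A D \<beta>" "q = Inr h" by blast
  have pq: "qm_dist A D \<beta> p q = sup_dist A f h" using f h by (simp add: qm_dist_def)
  show "(qm_dist A D \<beta> p q = 0) = (p = q)"
  proof
    assume "qm_dist A D \<beta> p q = 0"
    then have "f x = h x" if "x \<in> carrier A" for x
      using sup_dist_upper[OF f(1) h(1) that] pq by simp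
    then have "f = h"
      using f(1) h(1) by (intro extensionalityI[of _ "carrier A"]) (auto simp: near_equivariant_def)
    then show "p = q" using f h by simp
  next
    assume "p = q"
    then have "f = h" using f h by simp
    then have "sup_dist A f h \<le> 0" by (intro sup_dist_least) simp
    then show "qm_dist A D \<beta> p q = 0"
      using pq sup_dist_upper[OF f(1) h(1) A.one_closed] by linarith
  qed
  fix r :: "'l + ('a \<Rightarrow> real)" assume "r \<in> Inr ` near_equivariant A D \<beta>"
  then obtain k where k: "k \<in> near_equivariant A D \<beta>" "r = Inr k" by blast
  have "sup_dist A f k \<le> sup_dist A f h + sup_dist A h k"
  proof (rule sup_dist_least)
    fix x assume "x \<in> carrier A"
    from sup_dist_upper[OF f(1) h(1) this] sup_dist_upper[OF h(1) k(1) this]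
    show "\<bar>f x - k x\<bar> \<le> sup_dist A f h + sup_dist A h k" by linarith
  qed
  then show "qm_dist A D \<beta> p r \<le> qm_dist A D \<beta> p q + qm_dist A D \<beta> q r"
    using f h k by (simp add: qm_dist_def)
qed

lemma mspace_qm_line [simp]: "mspace (qm_line A D \<beta>) = Inr ` near_equivariant A D \<beta>"
  by (simp add: qm_line_def Metric_space.mspace_metric[OF Metric_space_qm])

lemma mdist_qm_line [simp]:
  "\<lbrakk>f \<in> near_equivariant A D \<beta>; h \<in> near_equivariant A D \<beta>\<rbrakk> \<Longrightarrow>
    mdist (qm_line A D \<beta>) (Inr f) (Inr h) = sup_dist A f h"
  by (simp add: qm_line_def Metric_space.mdist_metric[OF Metric_space_qm] qm_dist_def)

text \<open>The affine segment between two functions stays in the set, whose defining inequalities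
  are convex, and has constant speed in the uniform metric.\<close>

lemma is_path_metric_qm_line: "is_path_metric (qm_line A D \<beta> :: ('l + ('a \<Rightarrow> real)) metric)"
proof (rule is_path_metric_if_geodesic)
  let ?N = "near_equivariant A D \<beta>"
  fix p q :: "'l + ('a \<Rightarrow> real)"
  assume "p \<in> mspace (qm_line A D \<beta>)" "q \<in> mspace (qm_line A D \<beta>)"
  then obtain f h where f: "f \<in> ?N" "p = Inr f" and h: "h \<in> ?N" "q = Inr h" by auto
  define l where "l s = (\<lambda>x\<in>carrier A. (1 - s) * f x + s * h x)" for s :: real
  have l: "l s \<in> ?N" if s: "s \<in> {0..1}" for s
  proof -
    have "\<bar>l s (x \<otimes>\<^bsub>A\<^esub> y) - l s x - \<beta> y\<bar> \<le> D" if x: "x \<in> carrier A" and y: "y \<in> carrier A" for x y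
    proof -
      have "l s (x \<otimes>\<^bsub>A\<^esub> y) - l s x - \<beta> y =
          (1 - s) * (f (x \<otimes>\<^bsub>A\<^esub> y) - f x - \<beta> y) + s * (h (x \<otimes>\<^bsub>A\<^esub> y) - h x - \<beta> y)"
        using x y by (simp add: l_def algebra_simps)
      also have "\<bar>\<dots>\<bar> \<le> (1 - s) * D + s * D"
        using s near_equivariantD[OF f(1) x y] near_equivariantD[OF h(1) x y]
        by (intro order_trans[OF abs_triangle_ineq] add_mono) (auto simp: abs_mult mult_left_mono)
      finally show ?thesis by (simp add: algebra_simps)
    qed
    then show ?thesis by (simp add: near_equivariant_def l_def)
  qed
  have "l 0 = f" "l 1 = h"
    using f(1) h(1) by (auto simp: l_def near_equivariant_def extensional_def)
  moreover have "sup_dist A (l s) (l t) \<le> \<bar>s - t\<bar> * sup_dist A f h" for s t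
  proof (rule sup_dist_least)
    fix x assume x: "x \<in> carrier A"
    have "\<bar>l s x - l t x\<bar> = \<bar>s - t\<bar> * \<bar>f x - h x\<bar>"
      using x by (simp add: l_def abs_minus_commute algebra_simps flip: abs_mult)
    also have "\<dots> \<le> \<bar>s - t\<bar> * sup_dist A f h"
      by (rule mult_left_mono[OF sup_dist_upper[OF f(1) h(1) x]]) simp
    finally show "\<bar>l s x - l t x\<bar> \<le> \<bar>s - t\<bar> * sup_dist A f h" .
  qed
  ultimately show "\<exists>\<gamma>. \<gamma> 0 = p \<and> \<gamma> 1 = q \<and> \<gamma> \<in> {0..1} \<rightarrow> mspace (qm_line A D \<beta>) \<and>
      (\<forall>s\<in>{0..1}. \<forall>t\<in>{0..1}. mdist (qm_line A D \<beta>) (\<gamma> s) (\<gamma> t)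
        \<le> \<bar>s - t\<bar> * mdist (qm_line A D \<beta>) p q)"
    using l f h by (intro exI[of _ "\<lambda>s. Inr (l s)"]) auto
qed

lemma rough_line_qm_line:
  "rough_line (qm_line A D \<beta> :: ('l + ('a \<Rightarrow> real)) metric) (\<lambda>p. projr p \<one>\<^bsub>A\<^esub>) (2 * D)"
proof
  fix p q :: "'l + ('a \<Rightarrow> real)"
  assume "p \<in> mspace (qm_line A D \<beta>)" "q \<in> mspace (qm_line A D \<beta>)"
  then obtain f h where f: "f \<in> near_equivariant A D \<beta>" "p = Inr f"
    and h: "h \<in> near_equivariant A D \<beta>" "q = Inr h" by auto
  have "sup_dist A f h \<le> \<bar>f \<one>\<^bsub>A\<^esub> - h \<one>\<^bsub>A\<^esub>\<bar> + 2 * D"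
  proof (rule sup_dist_least)
    fix x assume "x \<in> carrier A"
    from near_equivariant_diff[OF f(1) h(1) this]
    show "\<bar>f x - h x\<bar> \<le> \<bar>f \<one>\<^bsub>A\<^esub> - h \<one>\<^bsub>A\<^esub>\<bar> + 2 * D" by linarith
  qed
  then show "\<bar>mdist (qm_line A D \<beta>) p q - \<bar>projr p \<one>\<^bsub>A\<^esub> - projr q \<one>\<^bsub>A\<^esub>\<bar>\<bar> \<le> 2 * D"
    using sup_dist_upper[OF f(1) h(1) A.one_closed] f h
      near_equivariant_diff[OF f(1) h(1) A.one_closed] by simp
next
  fix t :: real
  \<comment> \<open>Adding constants to \<open>\<beta>\<close> itself reaches every value at the
    identity; the quasimorphism bound is what puts \<open>\<beta>\<close> into the set.\<close>
  let ?f = "\<lambda>x\<in>carrier A. \<beta> x + (t - \<beta> \<one>\<^bsub>A\<^esub>)"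
  have "?f \<in> near_equivariant A D \<beta>"
    using quasimorphismD[OF quasimorphism] by (simp add: near_equivariant_def)
  then show "\<exists>p\<in>mspace (qm_line A D \<beta> :: ('l + ('a \<Rightarrow> real)) metric). projr p \<one>\<^bsub>A\<^esub> = t"
    by (intro bexI[of _ "Inr ?f"]) auto
qed

lemma quasi_line_qm_line: "quasi_line (qm_line A D \<beta> :: ('l + ('a \<Rightarrow> real)) metric)"
  using is_path_metric_qm_line rough_line.quasi_isometric_real[OF rough_line_qm_line]
  by (simp add: quasi_line_def)

text \<open>The defining condition concerns increments under right multiplication, which commutes
  with left translation.\<close>

lemma translate_near_equivariant:
  assumes f: "f \<in> near_equivariant A D \<beta>" and g: "g \<in> carrier A"
  shows "(\<lambda>x\<in>carrier A. f (g \<otimes>\<^bsub>A\<^esub> x)) \<in> near_equivariant A D \<beta>"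
proof -
  have "\<bar>f (g \<otimes>\<^bsub>A\<^esub> (x \<otimes>\<^bsub>A\<^esub> y)) - f (g \<otimes>\<^bsub>A\<^esub> x) - \<beta> y\<bar> \<le> D"
    if "x \<in> carrier A" "y \<in> carrier A" for x y
    using near_equivariantD[OF f, of "g \<otimes>\<^bsub>A\<^esub> x" y] g that by (simp add: A.m_assoc)
  then show ?thesis by (simp add: near_equivariant_def)
qed

lemma qm_action_Inr:
  "f \<in> near_equivariant A D \<beta> \<Longrightarrow>
    qm_action A D \<beta> g (Inr f) = Inr (\<lambda>x\<in>carrier A. f (inv\<^bsub>A\<^esub> g \<otimes>\<^bsub>A\<^esub> x))"
  by (simp add: qm_action_def)

lemma isometric_action_qm_action:
  "isometric_action A (qm_line A D \<beta> :: ('l + ('a \<Rightarrow> real)) metric) (qm_action A D \<beta>)"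
proof (rule isometric_actionI[OF A.is_group])
  let ?N = "near_equivariant A D \<beta>"
  fix g h and p q :: "'l + ('a \<Rightarrow> real)" assume g: "g \<in> carrier A" and p: "p \<in> mspace (qm_line A D \<beta>)"
  from p obtain f where f: "f \<in> ?N" "p = Inr f" by auto
  note tr = translate_near_equivariant[OF f(1)]
  show "qm_action A D \<beta> g p \<in> mspace (qm_line A D \<beta>)"
    using tr g f by (simp add: qm_action_Inr)
  show "qm_action A D \<beta> (g \<otimes>\<^bsub>A\<^esub> h) p = qm_action A D \<beta> g (qm_action A D \<beta> h p)"
    if h: "h \<in> carrier A"
    using tr[of "inv\<^bsub>A\<^esub> h"] g h f by (auto simp: qm_action_Inr A.inv_mult_group A.m_assoc)
  assume "q \<in> mspace (qm_line A D \<beta>)"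
  then obtain k where k: "k \<in> ?N" "q = Inr k" by auto
  have surj: "(\<lambda>x. inv\<^bsub>A\<^esub> g \<otimes>\<^bsub>A\<^esub> x) ` carrier A = carrier A"
    using g A.surj_const_mult[of "inv\<^bsub>A\<^esub> g"] by simp
  have "(\<lambda>x. \<bar>f (inv\<^bsub>A\<^esub> g \<otimes>\<^bsub>A\<^esub> x) - k (inv\<^bsub>A\<^esub> g \<otimes>\<^bsub>A\<^esub> x)\<bar>) ` carrier A =
      (\<lambda>x. \<bar>f x - k x\<bar>) ` (\<lambda>x. inv\<^bsub>A\<^esub> g \<otimes>\<^bsub>A\<^esub> x) ` carrier A"
    by (simp only: image_image)
  then have "sup_dist A (\<lambda>x\<in>carrier A. f (inv\<^bsub>A\<^esub> g \<otimes>\<^bsub>A\<^esub> x)) (\<lambda>x\<in>carrier A. k (inv\<^bsub>A\<^esub> g \<otimes>\<^bsub>A\<^esub> x))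
      = sup_dist A f k"
    unfolding sup_dist_def surj by (simp cong: image_cong)
  then show "mdist (qm_line A D \<beta>) (qm_action A D \<beta> g p) (qm_action A D \<beta> g q)
      = mdist (qm_line A D \<beta>) p q"
    using f k g translate_near_equivariant by (simp add: qm_action_Inr)
next
  fix p :: "'l + ('a \<Rightarrow> real)" assume "p \<in> mspace (qm_line A D \<beta>)"
  then obtain f where f: "f \<in> near_equivariant A D \<beta>" "p = Inr f" by auto
  then show "qm_action A D \<beta> \<one>\<^bsub>A\<^esub> p = p"
    by (auto simp: qm_action_Inr near_equivariant_def extensional_def fun_eq_iff)
next
  fix g show "qm_action A D \<beta> g \<in> extensional (mspace (qm_line A D \<beta> :: ('l + ('a \<Rightarrow> real)) metric))"
    unfolding qm_action_def mspace_qm_line by (rule restrict_extensional)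
qed

text \<open>Translation by \<open>g\<close> replaces the value at the identity by the value at the
  inverse of \<open>g\<close>, and near-equivariance compares the two. In coordinates the action
  moves every point by nearly the same amount.\<close>

lemma qm_action_displacement:
  assumes "g \<in> carrier A" "p \<in> mspace (qm_line A D \<beta>)"
  shows "\<bar>projr (qm_action A D \<beta> g p) \<one>\<^bsub>A\<^esub> - projr p \<one>\<^bsub>A\<^esub> - \<beta> (inv\<^bsub>A\<^esub> g)\<bar> \<le> D"
proof -
  obtain f where f: "f \<in> near_equivariant A D \<beta>" "p = Inr f" using assms(2) by auto
  then show ?thesis
    using near_equivariantD[OF f(1) A.one_closed, of "inv\<^bsub>A\<^esub> g"] assms(1) by (simp add: qm_action_Inr)
qed

lemma orientable_lineal_qm_action:
  assumes g: "g \<in> carrier A" and far: "\<And>K. \<exists>n::int. \<bar>\<beta> (g [^]\<^bsub>A\<^esub> n)\<bar> > K"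
  shows "orientable_lineal_action A (qm_line A D \<beta> :: ('l + ('a \<Rightarrow> real)) metric) (qm_action A D \<beta>)"
proof (rule rough_line.orientable_lineal_if_bounded_displacement[OF rough_line_qm_line A.is_group
      isometric_action_qm_action])
  fix h and p :: "'l + ('a \<Rightarrow> real)" assume "h \<in> carrier A" "p \<in> mspace (qm_line A D \<beta>)"
  from qm_action_displacement[OF this]
  show "\<bar>projr (qm_action A D \<beta> h p) \<one>\<^bsub>A\<^esub> - projr p \<one>\<^bsub>A\<^esub>\<bar> \<le> \<bar>\<beta> (inv\<^bsub>A\<^esub> h)\<bar> + D" by linarith
next
  have "\<exists>n::int. \<bar>projr (qm_action A D \<beta> (g [^]\<^bsub>A\<^esub> n) p) \<one>\<^bsub>A\<^esub> - projr p \<one>\<^bsub>A\<^esub>\<bar> > K"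
    if p: "p \<in> mspace (qm_line A D \<beta>)" for K and p :: "'l + ('a \<Rightarrow> real)"
  proof -
    obtain n :: int where n: "\<bar>\<beta> (g [^]\<^bsub>A\<^esub> n)\<bar> > K + D" using far by blast
    \<comment> \<open>The displacement involves the inverse, so the exponent changes sign.\<close>
    have "inv\<^bsub>A\<^esub> (g [^]\<^bsub>A\<^esub> (- n)) = g [^]\<^bsub>A\<^esub> n"
      using g by (simp add: A.int_pow_neg)
    then have "\<bar>projr (qm_action A D \<beta> (g [^]\<^bsub>A\<^esub> (- n)) p) \<one>\<^bsub>A\<^esub> - projr p \<one>\<^bsub>A\<^esub>\<bar> > K"
      using n qm_action_displacement[OF _ p, of "g [^]\<^bsub>A\<^esub> (- n)"] g by simp
    then show ?thesis by blast
  qed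
  then show "\<exists>g\<in>carrier A. \<forall>p\<in>mspace (qm_line A D \<beta> :: ('l + ('a \<Rightarrow> real)) metric). \<forall>K. \<exists>n::int.
      \<bar>projr (qm_action A D \<beta> (g [^]\<^bsub>A\<^esub> n) p) \<one>\<^bsub>A\<^esub> - projr p \<one>\<^bsub>A\<^esub>\<bar> > K"
    using g by blast
qed

end

section \<open>Actions on the product of the coordinate quasi-lines\<close>

context coordinatized_extension
begin

lemma quasi_retraction_imp_lineal_actions:
  assumes "quasi_retraction Z E \<iota> \<phi>"
  shows "\<exists>(L :: nat \<Rightarrow> ('l + ('e \<Rightarrow> real)) metric) a.
    (\<forall>i<r. quasi_line (L i) \<and> lineal_action E (L i) (a i) \<and>
       orientable_lineal_action E (L i) (a i)) \<and>
    geometric_action Z (l1_product r L) (\<lambda>z. diagonal_action r a L (\<iota> z))"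
proof -
  have qh: "quasi_hom E Z \<phi>" and \<phi>\<iota>: "\<And>z. z \<in> carrier Z \<Longrightarrow> \<phi> (\<iota> z) = z"
    using assms by (auto simp: quasi_retraction_def)
  define \<beta> where "\<beta> k e = real_of_int (\<kappa> k (\<phi> e))" for k e
  obtain D where D: "D \<ge> 0" "\<And>k. k < r \<Longrightarrow> quasimorphism E D (\<beta> k)"
    using quasi_hom_coord[OF E.is_group qh] unfolding \<beta>_def by blast
  have q: "quasimorphism_on E D (\<beta> k)" if "k < r" for k
    using D(2)[OF that] by (simp add: quasimorphism_on_def quasimorphism_on_axioms_def E.is_group)
  define L :: "nat \<Rightarrow> ('l + ('e \<Rightarrow> real)) metric" where "L k = qm_line E D (\<beta> k)" for k
  define a :: "nat \<Rightarrow> 'e \<Rightarrow> 'l + ('e \<Rightarrow> real) \<Rightarrow> 'l + ('e \<Rightarrow> real)"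
    where "a k = qm_action E D (\<beta> k)" for k
  define u :: "'l + ('e \<Rightarrow> real) \<Rightarrow> real" where "u p = projr p \<one>\<^bsub>E\<^esub>" for p
  have rough: "rough_line (L k) u (2 * D)" if "k < r" for k
    unfolding L_def u_def by (rule quasimorphism_on.rough_line_qm_line[OF q[OF that]])
  have lineal: "orientable_lineal_action E (L k) (a k)" if k: "k < r" for k
  proof -
    \<comment> \<open>A central element of coordinate 1 is the loxodromic one: since
      \<open>\<phi>\<close> is exact on \<open>Z\<close>, \<open>\<beta> k\<close> takes the value n
      on its n-th power.\<close>
    obtain z where z: "z \<in> carrier Z" "\<kappa> k z = 1" using coord_surj[of "\<lambda>_. 1"] k by blast
    have "\<beta> k (\<iota> z [^]\<^bsub>E\<^esub> int n) = real n" for n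
    proof -
      have "\<kappa> k (z [^]\<^bsub>Z\<^esub> n) = int n" by (induction n) (use z k in \<open>auto simp: coord_mult\<close>)
      then show ?thesis using z \<phi>\<iota> by (simp add: \<beta>_def int_pow_int flip: iota.hom_nat_pow)
    qed
    then have "\<exists>n::int. \<bar>\<beta> k (\<iota> z [^]\<^bsub>E\<^esub> n)\<bar> > K" for K
      using reals_Archimedean2[of K] by (metis abs_of_nat)
    then show ?thesis
      unfolding L_def a_def using z
      by (intro quasimorphism_on.orientable_lineal_qm_action[OF q[OF k], of "\<iota> z"]) auto
  qed
  \<comment> \<open>The action uses inverses, so \<open>z\<close> shifts by minus its coordinate;
    this is the origin of the sign in the choice of \<open>z\<close> for coboundedness.\<close>
  have shift: "\<bar>u (a k (\<iota> z) p) - u p + real_of_int (\<kappa> k z)\<bar> \<le> D"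
    if k: "k < r" and z: "z \<in> carrier Z" and p: "p \<in> mspace (L k)" for k z p
    using quasimorphism_on.qm_action_displacement[OF q[OF k], of "\<iota> z" p] that \<phi>\<iota>[of "inv\<^bsub>Z\<^esub> z"]
    by (simp add: L_def a_def u_def \<beta>_def coord_inv)
  have act: "isometric_action E (L k) (a k)" if "k < r" for k
    unfolding L_def a_def by (rule quasimorphism_on.isometric_action_qm_action[OF q[OF that]])
  have iso: "isometric_action Z (l1_product r L) (\<lambda>z. diagonal_action r a L (\<iota> z))"
    by (rule isometric_action_hom[OF isometric_action_diagonal[OF E.is_group act] group_hom_iota])
  have closed: "a k (\<iota> z) (x k) \<in> mspace (L k)"
    if "k < r" "z \<in> carrier Z" "x \<in> mspace (l1_product r L)" for k z x
    using that isometric_actionD(1)[OF act] by (auto simp: PiE_iff)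
  have "proper_action Z (l1_product r L) (\<lambda>z. diagonal_action r a L (\<iota> z))"
    unfolding proper_action_def
  proof (intro ballI allI impI)
    fix x and R :: real assume x: "x \<in> mspace (l1_product r L)" and "R > 0"
    show "finite {z \<in> carrier Z. mdist (l1_product r L) x (diagonal_action r a L (\<iota> z) x) \<le> R}"
    proof (rule finite_if_coord_bounded)
      fix z k
      assume "z \<in> {z \<in> carrier Z. mdist (l1_product r L) x (diagonal_action r a L (\<iota> z) x) \<le> R}"
        and k: "k < r"
      then have z: "z \<in> carrier Z" and "(\<Sum>k<r. mdist (L k) (x k) (a k (\<iota> z) (x k))) \<le> R"
        using x by (auto simp: diagonal_action_def)
      moreover have "mdist (L k) (x k) (a k (\<iota> z) (x k)) \<le> (\<Sum>k<r. mdist (L k) (x k) (a k (\<iota> z) (x k)))"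
        using k by (intro member_le_sum) auto
      moreover have xk: "x k \<in> mspace (L k)" using x k by (auto simp: PiE_iff)
      \<comment> \<open>\<open>2 * D\<close> from comparing the quasi-line with the real line and
        \<open>D\<close> from the displacement.\<close>
      ultimately show "\<bar>real_of_int (\<kappa> k z)\<bar> \<le> R + 3 * D"
        using rough_line.rough[OF rough[OF k] xk closed[OF k z x]] shift[OF k z xk] by linarith
    qed simp
  qed
  moreover have "cobounded_action Z (l1_product r L) (\<lambda>z. diagonal_action r a L (\<iota> z))"
  proof -
    have "\<exists>p. p \<in> mspace (L k) \<and> u p = 0" if "k < r" for k
      using rough_line.onto[OF rough[OF that]] by blast
    then obtain x0 where x0: "\<And>k. k < r \<Longrightarrow> x0 k \<in> mspace (L k) \<and> u (x0 k) = 0" by metis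
    define x where "x = restrict x0 {..<r}"
    have x: "x \<in> mspace (l1_product r L)" using x0 by (auto simp: x_def)
    have "\<exists>z\<in>carrier Z. mdist (l1_product r L) y (diagonal_action r a L (\<iota> z) x) \<le> real r * (3 * D + 1)"
      if y: "y \<in> mspace (l1_product r L)" for y
    proof -
      \<comment> \<open>One \<open>z\<close> serves all factors at once, as the coordinates are
        jointly onto. Rounding adds 1 to the error \<open>3 * D\<close> in each factor.\<close>
      obtain z where z: "z \<in> carrier Z" "\<forall>k<r. \<kappa> k z = - \<lfloor>u (y k)\<rfloor>"
        using coord_surj[of "\<lambda>k. - \<lfloor>u (y k)\<rfloor>"] by blast
      have "mdist (L k) (y k) (a k (\<iota> z) (x k)) \<le> 3 * D + 1" if k: "k < r" for k
      proof -
        have m: "y k \<in> mspace (L k)" "x k \<in> mspace (L k)" using x y k by (auto simp: PiE_iff)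
        have "u (x k) = 0" using x0 k by (simp add: x_def)
        moreover have "real_of_int (\<kappa> k z) = - real_of_int \<lfloor>u (y k)\<rfloor>" using z k by simp
        ultimately show ?thesis
          using rough_line.rough[OF rough[OF k] m(1) closed[OF k z(1) x]] shift[OF k z(1) m(2)]
          by linarith
      qed
      then have "(\<Sum>k<r. mdist (L k) (y k) (a k (\<iota> z) (x k))) \<le> (\<Sum>k<r. 3 * D + 1)"
        by (intro sum_mono) simp
      then show ?thesis using z(1) x by (intro bexI[of _ z]) (auto simp: diagonal_action_def)
    qed
    then show ?thesis
      unfolding cobounded_action_def using x D(1)
      by (intro bexI[of _ x] exI[of _ "real r * (3 * D + 1)"]) auto
  qed
  ultimately have "geometric_action Z (l1_product r L) (\<lambda>z. diagonal_action r a L (\<iota> z))"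
    using iso by (simp add: geometric_action_def)
  moreover have "quasi_line (L k)" if "k < r" for k
    unfolding L_def by (rule quasimorphism_on.quasi_line_qm_line[OF q[OF that]])
  ultimately show ?thesis
    using lineal orientable_lineal_action_def by blast
qed

end

text \<open>The coordinates are the components of the free part under the isomorphism. A bounded box
  contains finitely many lattice points, and each has as many preimages as \<open>F\<close> has
  elements.\<close>

lemma free_abelian_coordinates:
  fixes Z :: "('z, 'm) monoid_scheme" and F :: "('f, 'n) monoid_scheme"
  assumes Z: "group Z" and F: "finite (carrier F)"
    and iso: "Z \<cong> product_group {..<r} (\<lambda>_. integer_group) \<times>\<times> F"
  obtains \<kappa> :: "nat \<Rightarrow> 'z \<Rightarrow> int"
  where "\<And>k x y. \<lbrakk>k < r; x \<in> carrier Z; y \<in> carrier Z\<rbrakk> \<Longrightarrow> \<kappa> k (x \<otimes>\<^bsub>Z\<^esub> y) = \<kappa> k x + \<kappa> k y"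
    and "\<And>B. finite {z \<in> carrier Z. \<forall>k<r. \<bar>\<kappa> k z\<bar> \<le> B}"
    and "\<And>c. \<exists>z\<in>carrier Z. \<forall>k<r. \<kappa> k z = c k"
proof -
  let ?P = "product_group {..<r} (\<lambda>_. integer_group) \<times>\<times> F"
  obtain h where h: "h \<in> iso Z ?P" using iso by (auto simp: is_iso_def)
  have hom: "h \<in> hom Z ?P" and bij: "bij_betw h (carrier Z) (carrier ?P)"
    using h by (auto simp: iso_def)
  have P: "carrier ?P = (\<Pi>\<^sub>E i\<in>{..<r}. UNIV) \<times> carrier F" by simp
  show thesis
  proof
    fix k x y assume k: "k < r" and x: "x \<in> carrier Z" and y: "y \<in> carrier Z"
    show "fst (h (x \<otimes>\<^bsub>Z\<^esub> y)) k = fst (h x) k + fst (h y) k"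
      using hom_mult[OF hom x y] k by (cases "h x"; cases "h y") simp
  next
    fix B :: int
    let ?S = "{z \<in> carrier Z. \<forall>k<r. \<bar>fst (h z) k\<bar> \<le> B}"
    have "h ` ?S \<subseteq> (\<Pi>\<^sub>E i\<in>{..<r}. {-B..B}) \<times> carrier F"
    proof
      fix w assume "w \<in> h ` ?S"
      then obtain z where z: "z \<in> carrier Z" "\<And>k. k < r \<Longrightarrow> \<bar>fst (h z) k\<bar> \<le> B" "w = h z" by auto
      have "h z \<in> carrier ?P" using bij z(1) by (auto simp: bij_betw_def)
      then show "w \<in> (\<Pi>\<^sub>E i\<in>{..<r}. {-B..B}) \<times> carrier F"
        using z unfolding P by (cases "h z") (auto simp: PiE_iff abs_le_iff minus_le_iff)
    qed
    moreover have "finite ((\<Pi>\<^sub>E i\<in>{..<r}. {-B..B}) \<times> carrier F)"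
      using F by (intro finite_cartesian_product finite_PiE) auto
    ultimately have "finite (h ` ?S)" by (rule finite_subset)
    moreover have "inj_on h ?S" using bij by (auto simp: bij_betw_def intro: inj_on_subset)
    ultimately show "finite ?S" by (rule finite_imageD)
  next
    fix c :: "nat \<Rightarrow> int"
    have "h \<one>\<^bsub>Z\<^esub> \<in> carrier ?P"
      using bij_betw_apply[OF bij] monoid.one_closed[OF group.is_monoid[OF Z]] by blast
    then obtain f where "f \<in> carrier F" unfolding P by auto
    then have "(restrict c {..<r}, f) \<in> h ` carrier Z" using bij unfolding P bij_betw_def by auto
    then obtain z where "z \<in> carrier Z" "h z = (restrict c {..<r}, f)" by auto
    then show "\<exists>z\<in>carrier Z. \<forall>k<r. fst (h z) k = c k" by (auto intro!: bexI[of _ z])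
  qed
qed

(* HOL cannot quantify over all metric spaces regardless of their underlying type. In (4), the
   points of the quasi-lines lie in the type 'l + ('e => real). Since 'l is an arbitrary type,
   quasi-lines on any given type are covered; the second summand only guarantees that the type
   is large enough for the existence claim. *)
theorem proposition5p5:
  fixes Z :: "'z monoid" and E :: "'e monoid" and G :: "'g monoid"
    and \<iota> :: "'z \<Rightarrow> 'e" and \<pi> :: "'e \<Rightarrow> 'g"
    and r :: nat and F :: "'f monoid"
  assumes "central_extension Z E G \<iota> \<pi>"
    and "finitely_generated_group Z"
    and "comm_group F" and "finite (carrier F)"
    and "Z \<cong> product_group {..<r} (\<lambda>_. integer_group) \<times>\<times> F"
  shows "all_equivalent
    [bounded_class G (euler_class Z E G \<iota> \<pi>),
     quasi_splits E G \<pi>,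
     \<exists>\<phi>. quasi_retraction Z E \<iota> \<phi>,
     \<exists>(L :: nat \<Rightarrow> ('l + ('e \<Rightarrow> real)) metric) a.
       (\<forall>i<r. quasi_line (L i) \<and> lineal_action E (L i) (a i) \<and>
          orientable_lineal_action E (L i) (a i)) \<and>
       geometric_action Z (l1_product r L) (\<lambda>z. diagonal_action r a L (\<iota> z)),
     virtually_quasi_splits E G \<pi>]"
proof -
  interpret central_extension Z E G \<iota> \<pi> by (rule assms(1))
  obtain \<kappa> :: "nat \<Rightarrow> 'z \<Rightarrow> int" where "coordinatized_extension Z E G \<iota> \<pi> r \<kappa>"
  proof (rule free_abelian_coordinates[OF Z.is_group assms(4,5)])
    fix \<kappa> :: "nat \<Rightarrow> 'z \<Rightarrow> int"
    assume "\<And>k x y. \<lbrakk>k < r; x \<in> carrier Z; y \<in> carrier Z\<rbrakk> \<Longrightarrow> \<kappa> k (x \<otimes>\<^bsub>Z\<^esub> y) = \<kappa> k x + \<kappa> k y"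
      and "\<And>B. finite {z \<in> carrier Z. \<forall>k<r. \<bar>\<kappa> k z\<bar> \<le> B}"
      and "\<And>c. \<exists>z\<in>carrier Z. \<forall>k<r. \<kappa> k z = c k"
    then have "coordinatized_extension Z E G \<iota> \<pi> r \<kappa>" by unfold_locales
    then show thesis by (rule that)
  qed
  then interpret coordinatized_extension Z E G \<iota> \<pi> r \<kappa> .
  let ?lineal = "\<exists>(L :: nat \<Rightarrow> ('l + ('e \<Rightarrow> real)) metric) a.
       (\<forall>i<r. quasi_line (L i) \<and> lineal_action E (L i) (a i) \<and>
          orientable_lineal_action E (L i) (a i)) \<and>
       geometric_action Z (l1_product r L) (\<lambda>z. diagonal_action r a L (\<iota> z))"
  have "\<exists>\<phi>. quasi_retraction Z E \<iota> \<phi>" if lineal: ?lineal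
  proof -
    obtain L :: "nat \<Rightarrow> ('l + ('e \<Rightarrow> real)) metric" and a
      where "\<forall>i<r. lineal_action E (L i) (a i)"
        and geo: "geometric_action Z (l1_product r L) (\<lambda>z. diagonal_action r a L (\<iota> z))"
      using lineal by blast
    \<comment> \<open>Although only \<open>Z\<close> is assumed to act geometrically, all of
      \<open>E\<close> acts isometrically on the product, so orbits of \<open>E\<close> can be
      compared with orbits of \<open>Z\<close>.\<close>
    then have "isometric_action E (l1_product r L) (diagonal_action r a L)"
      by (intro isometric_action_diagonal E.is_group) (simp add: lineal_action_def)
    then show ?thesis using geo by (rule geometric_imp_quasi_retraction)
  qed
  moreover have "?lineal" if "\<exists>\<phi>. quasi_retraction Z E \<iota> \<phi>"
    using that quasi_retraction_imp_lineal_actions by blast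
  ultimately have lineal_iff: "?lineal \<longleftrightarrow> (\<exists>\<phi>. quasi_retraction Z E \<iota> \<phi>)" by (rule iffI)
  have splits_iff: "quasi_splits E G \<pi> \<longleftrightarrow> (\<exists>\<phi>. quasi_retraction Z E \<iota> \<phi>)"
    using quasi_splits_imp_quasi_retraction quasi_retraction_imp_quasi_splits by blast
  have virtually_iff: "virtually_quasi_splits E G \<pi> \<longleftrightarrow> (\<exists>\<phi>. quasi_retraction Z E \<iota> \<phi>)"
    using virtually_quasi_splits_imp_quasi_retraction quasi_splits_imp_virtually splits_iff by blast
  show ?thesis
    unfolding all_equivalent_def bounded_class_iff_quasi_splits splits_iff virtually_iff lineal_iff
    by simp
qed

end
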